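(* Let $n\ge 2$. The relation $\mathcal{R}\subset(\mathrm{Flag}^+(\mathbb{R}^n))^3$ defined by $(F_1,F_2,F_3)\in\mathcal{R}$ if and only if $(F_1,F_2,F_3)$ is hyperconvex is a partial cyclic order on $\mathrm{Flag}^+(\mathbb{R}^n)$.
   Context: Oriented flags. $\mathbb{R}^n$ has its standard orientation. Consider complete flags $F^{(1)}\subset\dots\subset F^{(n-1)}$ in $\mathbb{R}^n$ ($\dim F^{(i)}=i$) with a choice of orientation on each $F^{(i)}$. $\mathrm{Flag}^+(\mathbb{R}^n)$ is the set of these if $n$ is odd, and the quotient by simultaneously reversing the orientations of all odd-dimensional $F^{(i)}$ if $n$ is even; an oriented flag before passing to this quotient is called a lift (if $n$ is odd, a lift is the flag itself). Direct sums of oriented subspaces are oriented by concatenating positive bases in order; $F^{(0)}=\{0\}$. A triple $(F_1,F_2,F_3)$ in $\mathrm{Flag}^+(\mathbb{R}^n)$ is hyperconvex if there are lifts $\widehat F_1,\widehat F_2,\widehat F_3$ such that $\widehat F_1^{(i_1)}\oplus \widehat F_2^{(i_2)}\oplus \widehat F_3^{(i_3)}=\mathbb{R}^n$ as oriented vector spaces for all integers $0\le i_1,i_2,i_3\le n-1$ with $i_1+i_2+i_3=n$. A partial cyclic order on a set $C$ is a relation $\mathcal{R}\subset C^3$ such that for all $a,b,c,d\in C$: (cyclicity) $(a,b,c)\in\mathcal R\Rightarrow(b,c,a)\in\mathcal R$; (asymmetry) $(a,b,c)\in\mathcal R\Rightarrow(c,b,a)\notin\mathcal R$; (transitivity) $(a,b,c)\in\mathcal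 R$ and $(a,c,d)\in\mathcal R$ imply $(a,b,d)\in\mathcal R$. *)

theory Defs
  imports "Jordan_Normal_Form.VS_Connect" "HOL-Library.FuncSet"
begin

text \<open>\<open>\<real>\<^sup>n\<close> is modelled by \<^term>\<open>carrier_vec n :: real vec set\<close>.\<close>

abbreviation Rn :: "nat \<Rightarrow> (real, real vec) module" where
  "Rn n \<equiv> module_vec TYPE(real) n"

abbreviation sub_vs :: "nat \<Rightarrow> real vec set \<Rightarrow> (real, real vec) module" where
  "sub_vs n V \<equiv> (Rn n)\<lparr>carrier := V\<rparr>"


section \<open>Oriented subspaces\<close>

definition ordered_bases :: "nat \<Rightarrow> real vec set \<Rightarrow> real vec list set" where
  "ordered_bases n V =
     {bs. distinct bs \<and> vectorspace.basis class_ring (sub_vs n V) (set bs)}"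

text \<open>The matrix \<open>A\<close> below is the change-of-basis matrix. For \<open>V = {0}\<close> it is the \<open>0 \<times> 0\<close> matrix,
  whose determinant is 1.\<close>

definition same_orientation :: "nat \<Rightarrow> real vec set \<Rightarrow> (real vec list \<times> real vec list) set" where
  "same_orientation n V =
     {(bs, cs). bs \<in> ordered_bases n V \<and> cs \<in> ordered_bases n V \<and>
        (\<exists>A \<in> carrier_mat (length bs) (length cs).
           0 < det A \<and> mat_of_cols n cs = mat_of_cols n bs * A)}"

text \<open>An oriented subspace is a subspace together with the set of its positive ordered bases,
  which is an equivalence class of ordered bases.\<close>

type_synonym oriented_space = "real vec set \<times> real vec list set"

definition oriented_subspaces :: "nat \<Rightarrow> oriented_space set" where
  "oriented_subspaces n =
     {(V, P). subspace class_ring V (Rn n) \<and> P \<in> ordered_bases n V // same_orientation n V}"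

text \<open>Only used in positive dimension, where a subspace has exactly two orientations.\<close>

definition reverse_orientation :: "nat \<Rightarrow> oriented_space \<Rightarrow> oriented_space" where
  "reverse_orientation n X = (fst X, ordered_bases n (fst X) - snd X)"

definition standard_oriented_Rn :: "nat \<Rightarrow> oriented_space" where
  "standard_oriented_Rn n =
     (carrier_vec n, same_orientation n (carrier_vec n) `` {unit_vecs n})"

definition independent_sum :: "nat \<Rightarrow> oriented_space \<Rightarrow> oriented_space \<Rightarrow> bool" where
  "independent_sum n X Y \<longleftrightarrow> fst X \<inter> fst Y = {0\<^sub>v n}"

text \<open>Only meaningful when \<^const>\<open>independent_sum\<close> holds.\<close>

definition oriented_sum :: "nat \<Rightarrow> oriented_space \<Rightarrow> oriented_space \<Rightarrow> oriented_space" where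
  "oriented_sum n X Y =
     (let S = module.submodule_sum (Rn n) (fst X) (fst Y)
      in (S, {cs. \<exists>bs \<in> snd X. \<exists>bs' \<in> snd Y. (bs @ bs', cs) \<in> same_orientation n S}))"


section \<open>Oriented flags\<close>

definition oriented_flags :: "nat \<Rightarrow> (nat \<Rightarrow> oriented_space) set" where
  "oriented_flags n =
     {F \<in> {1..n-1} \<rightarrow>\<^sub>E oriented_subspaces n.
        (\<forall>i\<in>{1..n-1}. vectorspace.dim class_ring (sub_vs n (fst (F i))) = i) \<and>
        (\<forall>i\<in>{1..n-1}. \<forall>j\<in>{1..n-1}. i \<le> j \<longrightarrow> fst (F i) \<subseteq> fst (F j))}"

definition flip_odd :: "nat \<Rightarrow> (nat \<Rightarrow> oriented_space) \<Rightarrow> nat \<Rightarrow> oriented_space" where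
  "flip_odd n F = (\<lambda>i\<in>{1..n-1}. if odd i then reverse_orientation n (F i) else F i)"

definition flag_rel :: "nat \<Rightarrow> ((nat \<Rightarrow> oriented_space) \<times> (nat \<Rightarrow> oriented_space)) set" where
  "flag_rel n =
     {(F, G). F \<in> oriented_flags n \<and> G \<in> oriented_flags n \<and>
        (G = F \<or> even n \<and> G = flip_odd n F)}"

text \<open>An element of \<open>Flag_plus n\<close> is the set of its lifts. For odd \<open>n\<close> this is the singleton of an
  oriented flag, so that \<open>Flag_plus n\<close> is then in canonical bijection with \<open>oriented_flags n\<close>.\<close>

definition Flag_plus :: "nat \<Rightarrow> (nat \<Rightarrow> oriented_space) set set" where
  "Flag_plus n = oriented_flags n // flag_rel n"

text \<open>Extends a flag by \<open>F\<^sup>(\<^sup>0\<^sup>) = {0}\<close>, whose only ordered basis, the empty one, is positive.\<close>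

definition flag_space :: "nat \<Rightarrow> (nat \<Rightarrow> oriented_space) \<Rightarrow> nat \<Rightarrow> oriented_space" where
  "flag_space n F i = (if i = 0 then ({0\<^sub>v n}, {[]}) else F i)"

definition hyperconvex ::
  "nat \<Rightarrow> (nat \<Rightarrow> oriented_space) set \<Rightarrow> (nat \<Rightarrow> oriented_space) set \<Rightarrow>
     (nat \<Rightarrow> oriented_space) set \<Rightarrow> bool" where
  "hyperconvex n F1 F2 F3 \<longleftrightarrow>
     (\<exists>G1\<in>F1. \<exists>G2\<in>F2. \<exists>G3\<in>F3.
        \<forall>i1\<in>{0..n-1}. \<forall>i2\<in>{0..n-1}. \<forall>i3\<in>{0..n-1}. i1 + i2 + i3 = n \<longrightarrow>
          (let X1 = flag_space n G1 i1; X2 = flag_space n G2 i2; X3 = flag_space n G3 i3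
           in independent_sum n X1 X2 \<and>
              independent_sum n (oriented_sum n X1 X2) X3 \<and>
              oriented_sum n (oriented_sum n X1 X2) X3 = standard_oriented_Rn n))"


section \<open>Partial cyclic orders\<close>

definition partial_cyclic_order :: "'a set \<Rightarrow> ('a \<times> 'a \<times> 'a) set \<Rightarrow> bool" where
  "partial_cyclic_order C R \<longleftrightarrow>
     R \<subseteq> C \<times> C \<times> C \<and>
     (\<forall>a\<in>C. \<forall>b\<in>C. \<forall>c\<in>C. (a, b, c) \<in> R \<longrightarrow> (b, c, a) \<in> R) \<and>
     (\<forall>a\<in>C. \<forall>b\<in>C. \<forall>c\<in>C. (a, b, c) \<in> R \<longrightarrow> (c, b, a) \<notin> R) \<and>
     (\<forall>a\<in>C. \<forall>b\<in>C. \<forall>c\<in>C. \<forall>d\<in>C. (a, b, c) \<in> R \<and> (a, c, d) \<in> R \<longrightarrow> (a, b, d) \<in> R)"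

end

theory Submission
  imports Defs
begin

text \<open>
  Choose for every lift of a flag a frame whose initial segments are positive bases of the members of
  the flag. A triple of lifts \<open>a\<close>, \<open>b\<close>, \<open>c\<close> then satisfies the direct sum condition for given indices
  if and only if the determinant with columns \<open>a\<^sub>1, \<dots>, a\<^sub>i, b\<^sub>1, \<dots>, b\<^sub>j, c\<^sub>1, \<dots>, c\<^sub>k\<close> is positive
  (\<open>oriented_triple_sum_iff\<close>). Passing to the other lift, which exists for even \<open>n\<close> only, negates the
  whole frame (\<open>adapted_flip_odd\<close>). Hyperconvexity becomes the positivity of a family of determinants
  up to a choice of three signs (\<open>hyperconvex_iff\<close>).

  Cyclicity and asymmetry are then computations of the signs of block permutations, carried out in
  \<open>positive_triple_rotate\<close> and \<open>positive_triple_not_reversed\<close>.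

  For transitivity the signs can be normalised so that both triples use the same lifts of the two
  common flags. The determinants \<open>P(i, j, k, l)\<close> of four blocks taken from \<open>a\<close>, \<open>b\<close>, \<open>c\<close>, \<open>d\<close> are then
  all positive: the hypotheses are the cases \<open>l = 0\<close> and \<open>j = 0\<close>, and the three-term Pluecker relation
  \<open>P(i+1, j, k+1, l) P(i, j+1, k, l+1) = P(i+1, j, k, l+1) P(i, j+1, k+1, l) + P(i+1, j+1, k, l) P(i, j, k+1, l+1)\<close>
  propagates positivity by induction on \<open>j + l\<close> (\<open>positive_quadruple\<close>). The case \<open>k = 0\<close> is
  the transitivity claim.
\<close>


section \<open>Determinants of lists of columns\<close>

abbreviation cdet :: "nat \<Rightarrow> real vec list \<Rightarrow> real" where
  "cdet n vs \<equiv> det (mat_of_cols n vs)"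

lemma mat_of_cols_append:
  "mat_of_cols n (xs @ ys) =
     four_block_mat (mat_of_cols n xs) (mat_of_cols n ys) (0\<^sub>m 0 (length xs)) (0\<^sub>m 0 (length ys))"
  by (rule eq_matI) (auto simp: mat_of_cols_index nth_append)

lemma mat_of_cols_append_mult_vec:
  assumes "c \<in> carrier_vec (length xs)" and "d \<in> carrier_vec (length ys)"
  shows "mat_of_cols n (xs @ ys) *\<^sub>v (c @\<^sub>v d) =
           mat_of_cols n xs *\<^sub>v c + mat_of_cols n ys *\<^sub>v d"
  by (rule eq_vecI)
    (use assms in \<open>auto simp: mat_of_cols_append
       four_block_mat_mult_vec[where ?nr1.0 = n and ?nr2.0 = 0 and ?nc1.0 = "length xs" and ?nc2.0 = "length ys"]\<close>)

lemma cdet_swap_initial_blocks: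
  assumes "length (xs @ ys @ vs) = n"
  shows "cdet n (xs @ ys @ vs) = (- 1) ^ (length xs * length ys) * cdet n (ys @ xs @ vs)"
proof -
  have "mat n n (\<lambda>(i, j). mat_of_cols n (xs @ ys @ vs) $$
          (i, if j < length ys then j + length xs else
              if j < length xs + length ys then j - length ys else j)) = mat_of_cols n (ys @ xs @ vs)"
    using assms by (intro eq_matI) (auto simp: mat_of_cols_index nth_append add.commute)
  moreover have "mat_of_cols n (xs @ ys @ vs) \<in> carrier_mat n n"
    using assms by (metis mat_of_cols_carrier(1))
  ultimately show ?thesis
    using det_swap_initial_cols[of "mat_of_cols n (xs @ ys @ vs)" n "length xs" "length ys"] assms
    by simp
qed

lemma cdet_swap_blocks:
  assumes "length (us @ xs @ ys @ vs) = n"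
  shows "cdet n (us @ xs @ ys @ vs) = (- 1) ^ (length xs * length ys) * cdet n (us @ ys @ xs @ vs)"
proof -
  have "cdet n (us @ xs @ ys @ vs) =
          (- 1) ^ (length us * length (xs @ ys)) * cdet n (xs @ ys @ us @ vs)"
    using cdet_swap_initial_blocks[of us "xs @ ys" vs n] assms by simp
  also have "cdet n (xs @ ys @ us @ vs) =
          (- 1) ^ (length xs * length ys) * cdet n (ys @ xs @ us @ vs)"
    using cdet_swap_initial_blocks[of xs ys "us @ vs" n] assms by simp
  also have "cdet n (ys @ xs @ us @ vs) =
          (- 1) ^ (length us * length (xs @ ys)) * cdet n (us @ ys @ xs @ vs)"
    using cdet_swap_initial_blocks[of "ys @ xs" us vs n] assms by (simp add: ac_simps)
  finally show ?thesis
    by (simp add: minus_one_power_iff)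
qed

text \<open>Replacing one block of columns by combinations of its own columns multiplies the matrix on the
  right by a block diagonal matrix once the block has been moved to the front; moving it there and
  back costs the same sign twice. This is what makes the sign of a determinant depend only on the
  oriented subspaces spanned by the blocks.\<close>

lemma cdet_change_basis:
  assumes A: "A \<in> carrier_mat (length xs) (length xs)"
    and eq: "mat_of_cols n ys = mat_of_cols n xs * A"
    and len: "length (us @ xs @ vs) = n"
  shows "cdet n (us @ ys @ vs) = det A * cdet n (us @ xs @ vs)"
proof -
  have lys: "length ys = length xs"
    using arg_cong[OF eq, of dim_col] A by simp
  have initial: "cdet n (ys @ ws) = det A * cdet n (xs @ ws)" if l: "length (xs @ ws) = n" for ws
  proof -
    let ?B = "four_block_mat A (0\<^sub>m (length xs) (length ws)) (0\<^sub>m (length ws) (length xs)) (1\<^sub>m (length ws))"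
    have B: "?B \<in> carrier_mat n n" and M: "mat_of_cols n (xs @ ws) \<in> carrier_mat n n"
      using A l by (auto simp del: length_append simp: length_append[symmetric])
    have "mat_of_cols n (xs @ ws) * ?B = mat_of_cols n (ys @ ws)"
      unfolding mat_of_cols_append eq
      by (subst mult_four_block_mat[of _ n "length xs" _ "length ws" _ 0 _ _ "length xs" _ "length ws"])
        (use A lys in auto)
    then have "cdet n (ys @ ws) = cdet n (xs @ ws) * det ?B"
      using det_mult[OF M B] by simp
    also have "det ?B = det A"
      by (subst det_four_block_mat_lower_left_zero) (use A in auto)
    finally show ?thesis by simp
  qed
  have "cdet n (us @ ys @ vs) = (- 1) ^ (length us * length ys) * cdet n (ys @ us @ vs)"
    using cdet_swap_initial_blocks[of us ys vs n] len lys by simp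
  also have "cdet n (ys @ us @ vs) = det A * cdet n (xs @ us @ vs)"
    using initial[of "us @ vs"] len by simp
  also have "cdet n (xs @ us @ vs) = (- 1) ^ (length us * length ys) * cdet n (us @ xs @ vs)"
    using cdet_swap_initial_blocks[of xs us vs n] len lys by (simp add: ac_simps)
  finally show ?thesis
    by (simp add: minus_one_power_iff)
qed

lemma nonzero_det_solve:
  fixes M :: "real mat"
  assumes M: "M \<in> carrier_mat n n" and d: "det M \<noteq> 0" and b: "b \<in> carrier_vec n"
  obtains x where "x \<in> carrier_vec n" and "M *\<^sub>v x = b"
proof -
  obtain N where N: "N \<in> carrier_mat n n" "M * N = 1\<^sub>m n"
    using det_non_zero_imp_unit[OF M d] M by (auto simp: Units_def ring_mat_def)
  have "M *\<^sub>v (N *\<^sub>v b) = b"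
    using N M b by (metis assoc_mult_mat_vec one_mult_mat_vec)
  with N b that[of "N *\<^sub>v b"] show ?thesis by auto
qed

text \<open>In the coordinates given by the columns of \<open>M\<close>, the list \<open>W\<close> consists of the first \<open>m\<close> unit
  vectors, so that only the \<open>2 \<times> 2\<close> minor of the last two coordinates remains.\<close>

lemma cdet_replace_last_two:
  assumes M: "M = mat_of_cols (Suc (Suc m)) (W @ [a, c])" and W: "length W = m"
    and x: "x \<in> carrier_vec (Suc (Suc m))" and y: "y \<in> carrier_vec (Suc (Suc m))"
  shows "cdet (Suc (Suc m)) (W @ [M *\<^sub>v x, M *\<^sub>v y]) = det M * (x $ m * y $ Suc m - x $ Suc m * y $ m)"
proof -
  let ?n = "Suc (Suc m)"
  let ?B = "mat m 2 (\<lambda>(i, j). if j = 0 then x $ i else y $ i)"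
  let ?C = "mat 2 2 (\<lambda>(i, j). if j = 0 then x $ (i + m) else y $ (i + m))"
  let ?N = "four_block_mat (1\<^sub>m m) ?B (0\<^sub>m 2 m) ?C"
  have Mc: "M \<in> carrier_mat ?n ?n"
    using mat_of_cols_carrier(1)[of ?n "W @ [a, c]"] W unfolding M by simp
  have N: "?N \<in> carrier_mat ?n ?n"
    using four_block_carrier_mat[of "1\<^sub>m m" m m ?C 2 2] by simp
  have col: "col ?N j = (if j < m then unit_vec ?n j else if j = m then x else y)" if "j < ?n" for j
  proof (rule eq_vecI)
    fix i assume "i < dim_vec (if j < m then unit_vec ?n j else if j = m then x else y)"
    then have "i < m \<or> i = m \<or> i = Suc m" using x y by (auto split: if_splits)
    moreover have "j < m \<or> j = m \<or> j = Suc m" using that by auto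
    ultimately show "col ?N j $ i = (if j < m then unit_vec ?n j else if j = m then x else y) $ i"
      by (elim disjE) simp_all
  qed (use that x y in simp)
  have "M * ?N = mat_of_cols ?n (W @ [M *\<^sub>v x, M *\<^sub>v y])"
  proof (rule eq_matI)
    fix i j assume "i < dim_row (mat_of_cols ?n (W @ [M *\<^sub>v x, M *\<^sub>v y]))"
      and "j < dim_col (mat_of_cols ?n (W @ [M *\<^sub>v x, M *\<^sub>v y]))"
    then have i: "i < ?n" and j: "j < ?n" using W by auto
    have ij: "(M * ?N) $$ (i, j) = row M i \<bullet> col ?N j"
      using Mc N i j by (auto simp del: col_four_block_mat)
    show "(M * ?N) $$ (i, j) = mat_of_cols ?n (W @ [M *\<^sub>v x, M *\<^sub>v y]) $$ (i, j)"
      unfolding ij col[OF j] using i j W Mc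
      by (auto simp: mat_of_cols_index nth_append M less_Suc_eq)
  qed (use Mc W in auto)
  then have "cdet ?n (W @ [M *\<^sub>v x, M *\<^sub>v y]) = det M * det ?N"
    using det_mult[OF Mc N] by simp
  also have "det ?N = det ?C"
    by (subst det_four_block_mat_lower_left_zero) auto
  also have "det ?C = x $ m * y $ Suc m - x $ Suc m * y $ m"
    by (subst laplace_expansion_column[of _ 2 0])
      (auto simp: numeral_2_eq_2 cofactor_def mat_delete_def det_single)
  finally show ?thesis .
qed

text \<open>The three-term Pluecker relation. Modulo the span of \<open>W\<close> the space is a plane with basis
  \<open>a\<close>, \<open>c\<close>, and the identity is the one between the \<open>2 \<times> 2\<close> minors of four vectors in a plane.\<close>

lemma pluecker_relation:
  assumes W: "length W = m" and dim: "n = Suc (Suc m)"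
    and car: "a \<in> carrier_vec n" "b \<in> carrier_vec n" "c \<in> carrier_vec n" "d \<in> carrier_vec n"
    and ac: "cdet n (W @ [a, c]) \<noteq> 0"
  shows "cdet n (W @ [a, c]) * cdet n (W @ [b, d]) =
         cdet n (W @ [a, d]) * cdet n (W @ [b, c]) + cdet n (W @ [a, b]) * cdet n (W @ [c, d])"
proof -
  define M where "M = mat_of_cols n (W @ [a, c])"
  have M: "M \<in> carrier_mat n n" 
    using mat_of_cols_carrier(1)[of n "W @ [a, c]"] W dim unfolding M_def by simp
  have Md: "det M \<noteq> 0" using ac by (simp add: M_def)
  obtain x where x: "x \<in> carrier_vec n" "M *\<^sub>v x = b" using nonzero_det_solve[OF M Md car(2)] .
  obtain y where y: "y \<in> carrier_vec n" "M *\<^sub>v y = d" using nonzero_det_solve[OF M Md car(4)] .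
  have a: "M *\<^sub>v unit_vec n m = a" and c: "M *\<^sub>v unit_vec n (Suc m) = c"
    using car W dim by (auto simp: M_def mat_of_cols_index nth_append intro!: eq_vecI)
  have D: "cdet n (W @ [M *\<^sub>v p, M *\<^sub>v q]) = det M * (p $ m * q $ Suc m - p $ Suc m * q $ m)"
    if "p \<in> carrier_vec n" "q \<in> carrier_vec n" for p q
    using cdet_replace_last_two[of M m W a c p q] that W dim by (simp add: M_def)
  have u: "unit_vec n m \<in> carrier_vec n" "unit_vec n (Suc m) \<in> carrier_vec n" by simp_all
  note D' = D[OF u(1) y(1)] D[OF x(1) y(1)] D[OF x(1) u(2)] D[OF u(1) x(1)] D[OF u(2) y(1)] D[OF u]
  show ?thesis
    unfolding D'[unfolded a c x(2) y(2)] using dim by (simp add: algebra_simps)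
qed


section \<open>Ordered bases as columns of matrices\<close>

definition colspan :: "nat \<Rightarrow> real vec list \<Rightarrow> real vec set" where
  "colspan n bs = (\<lambda>c. mat_of_cols n bs *\<^sub>v c) ` carrier_vec (length bs)"

text \<open>Independence of the list as a family, so that a repeated vector makes it dependent.\<close>

definition lin_indep :: "nat \<Rightarrow> real vec list \<Rightarrow> bool" where
  "lin_indep n bs \<longleftrightarrow>
     (\<forall>c\<in>carrier_vec (length bs). mat_of_cols n bs *\<^sub>v c = 0\<^sub>v n \<longrightarrow> c = 0\<^sub>v (length bs))"

lemma lin_indepD:
  "lin_indep n bs \<Longrightarrow> c \<in> carrier_vec (length bs) \<Longrightarrow> mat_of_cols n bs *\<^sub>v c = 0\<^sub>v n
    \<Longrightarrow> c = 0\<^sub>v (length bs)"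
  by (simp add: lin_indep_def)

lemma mat_of_cols_mult_zero: "mat_of_cols n bs *\<^sub>v 0\<^sub>v (length bs) = 0\<^sub>v n"
  by (intro eq_vecI) auto

lemma zero_in_colspan: "0\<^sub>v n \<in> colspan n bs"
  unfolding colspan_def
  by (rule image_eqI[of _ _ "0\<^sub>v (length bs)"]) (simp_all add: mat_of_cols_mult_zero)

lemma colspan_eq_span:
  assumes "set bs \<subseteq> carrier_vec n"
  shows "colspan n bs = LinearCombinations.module.span class_ring (Rn n) (set bs)"
proof -
  interpret vec_space "TYPE(real)" n .
  have dim: "\<forall>w\<in>set bs. dim_vec w = n" using assms by (metis carrier_vecD subsetD)
  have "lincomb_list f bs \<in> colspan n bs" for f
    using lincomb_list_as_mat_mult[OF dim, of f] by (force simp: colspan_def)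
  moreover have "mat_of_cols n bs *\<^sub>v c \<in> span_list bs" if "c \<in> carrier_vec (length bs)" for c
  proof -
    have "vec (length bs) (\<lambda>i. c $ i) = c" using that by auto
    then have "mat_of_cols n bs *\<^sub>v c = lincomb_list (\<lambda>i. c $ i) bs"
      using lincomb_list_as_mat_mult[OF dim, of "\<lambda>i. c $ i"] by simp
    then show ?thesis by (auto simp: span_list_def)
  qed
  ultimately have "colspan n bs = span_list bs"
    by (auto simp: colspan_def span_list_def)
  then show ?thesis
    using span_list_as_span[OF assms] by simp
qed

lemma lin_indep_iff:
  assumes "set bs \<subseteq> carrier_vec n"
  shows "lin_indep n bs \<longleftrightarrow> distinct bs \<and> \<not> LinearCombinations.module.lin_dep class_ring (Rn n) (set bs)"
proof -
  interpret vec_space "TYPE(real)" n .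
  have dim: "\<forall>w\<in>set bs. dim_vec w = n" using assms by (metis carrier_vecD subsetD)
  have lc: "lincomb a (set bs) = mat_of_cols n bs *\<^sub>v vec (length bs) (\<lambda>i. a (bs ! i))"
    if "distinct bs" for a
    using lincomb_as_lincomb_list_distinct[OF assms that, of a]
      lincomb_list_as_mat_mult[OF dim, of "\<lambda>i. a (bs ! i)"] by simp
  show ?thesis
  proof (intro iffI conjI)
    assume ind: "lin_indep n bs"
    show dist: "distinct bs"
    proof (rule ccontr)
      assume "\<not> distinct bs"
      then obtain i j where ij: "i < length bs" "j < length bs" "i \<noteq> j" "bs ! i = bs ! j"
        by (auto simp: distinct_conv_nth)
      let ?c = "unit_vec (length bs) i - unit_vec (length bs) j :: real vec"
      have "mat_of_cols n bs *\<^sub>v ?c = 0\<^sub>v n"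
        using ij by (intro eq_vecI) (auto simp: scalar_prod_minus_distrib[of _ "length bs"] mat_of_cols_index)
      then have "?c = 0\<^sub>v (length bs)"
        by (intro lin_indepD[OF ind]) auto
      then have "?c $ i = 0" using ij by simp
      then show False using ij by simp
    qed
    show "\<not> lin_dep (set bs)"
    proof (rule finite_lin_indpt2)
      fix a assume "lincomb a (set bs) = 0\<^sub>v n"
      then have "mat_of_cols n bs *\<^sub>v vec (length bs) (\<lambda>i. a (bs ! i)) = 0\<^sub>v n"
        using lc[OF dist] by simp
      then have z: "vec (length bs) (\<lambda>i. a (bs ! i)) = 0\<^sub>v (length bs)"
        by (intro lin_indepD[OF ind]) auto
      have "a (bs ! i) = 0" if "i < length bs" for i
        using arg_cong[OF z, of "\<lambda>v. v $ i"] that by simp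
      then show "\<forall>v\<in>set bs. a v = 0" by (auto simp: in_set_conv_nth)
    qed (use assms in auto)
  next
    assume "distinct bs \<and> \<not> lin_dep (set bs)"
    then have dist: "distinct bs" and li: "\<not> lin_dep (set bs)" by auto
    show "lin_indep n bs"
      unfolding lin_indep_def
    proof (intro ballI impI)
      fix c :: "real vec" assume c: "c \<in> carrier_vec (length bs)" and z: "mat_of_cols n bs *\<^sub>v c = 0\<^sub>v n"
      define a where "a v = c $ (THE i. i < length bs \<and> bs ! i = v)" for v
      have a: "a (bs ! i) = c $ i" if "i < length bs" for i
      proof -
        have "(THE k. k < length bs \<and> bs ! k = bs ! i) = i"
          using that dist by (intro the_equality) (auto simp: nth_eq_iff_index_eq)
        then show ?thesis by (simp add: a_def)
      qed
      have "vec (length bs) (\<lambda>i. a (bs ! i)) = c"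
        using c a by (intro eq_vecI) auto
      then have lc0: "lincomb a (set bs) = 0\<^sub>v n"
        using lc[OF dist, of a] z by simp
      have "a v = 0" if "v \<in> set bs" for v
        using lin_dep_crit[of "set bs" "set bs" v a] that lc0 li by auto
      then show "c = 0\<^sub>v (length bs)"
        using c a by (intro eq_vecI) (auto simp flip: a)
    qed
  qed
qed

lemma subspace_colspan:
  assumes "set bs \<subseteq> carrier_vec n"
  shows "subspace class_ring (colspan n bs) (Rn n)"
proof -
  interpret vec_space "TYPE(real)" n .
  show ?thesis
    using span_is_subspace[of "set bs"] assms by (simp add: colspan_eq_span)
qed

lemma subspace_vectorspace:
  assumes "subspace class_ring V (Rn n)"
  shows "vectorspace class_ring (sub_vs n V)" and "V \<subseteq> carrier_vec n"
proof -
  interpret vec_space "TYPE(real)" n .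
  show "vectorspace class_ring (sub_vs n V)" by (rule subspace_is_vs[OF assms])
  show "V \<subseteq> carrier_vec n"
    using assms by (auto simp: subspace_def submodule_def module_vec_simps)
qed

lemma colspan_subset:
  assumes V: "subspace class_ring V (Rn n)" and bs: "set bs \<subseteq> V"
  shows "colspan n bs \<subseteq> V"
proof -
  interpret vec_space "TYPE(real)" n .
  have "set bs \<subseteq> carrier_vec n" using bs subspace_vectorspace(2)[OF V] by auto
  then show ?thesis
    using span_is_subset[OF bs] V by (simp add: colspan_eq_span subspace_def)
qed

lemma set_subset_colspan:
  assumes "set bs \<subseteq> carrier_vec n"
  shows "set bs \<subseteq> colspan n bs"
proof -
  interpret vec_space "TYPE(real)" n .
  show ?thesis using in_own_span[OF assms] by (simp add: colspan_eq_span[OF assms])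
qed

text \<open>Describing a basis by the columns of its matrix turns changes of basis into matrix equations and
  orientations into signs of determinants.\<close>

lemma ordered_bases_iff:
  assumes V: "subspace class_ring V (Rn n)"
  shows "bs \<in> ordered_bases n V \<longleftrightarrow>
           set bs \<subseteq> carrier_vec n \<and> lin_indep n bs \<and> colspan n bs = V"
proof -
  interpret vec_space "TYPE(real)" n .
  interpret sv: vectorspace class_ring "sub_vs n V" by (rule subspace_vectorspace(1)[OF V])
  have sub: "submodule class_ring V (Rn n)" using V by (simp add: subspace_def)
  have car: "V \<subseteq> carrier_vec n" by (rule subspace_vectorspace(2)[OF V])
  have "sv.basis (set bs) \<longleftrightarrow> \<not> lin_dep (set bs) \<and> span (set bs) = V" if "set bs \<subseteq> V"
    using span_li_not_depend[OF that sub] that by (simp add: sv.basis_def)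
  moreover have "set bs \<subseteq> V" if "set bs \<subseteq> carrier_vec n" "span (set bs) = V"
    using in_own_span[OF that(1)] that(2) by simp
  moreover have "set bs \<subseteq> V" if "sv.basis (set bs)"
    using that by (simp add: sv.basis_def)
  ultimately show ?thesis
    using lin_indep_iff[of bs n] colspan_eq_span[of bs n] car
    by (auto simp: ordered_bases_def)
qed

lemma ordered_bases_length:
  assumes V: "subspace class_ring V (Rn n)" and bs: "bs \<in> ordered_bases n V"
  shows "length bs = vectorspace.dim class_ring (sub_vs n V)"
proof -
  interpret sv: vectorspace class_ring "sub_vs n V" by (rule subspace_vectorspace(1)[OF V])
  show ?thesis
    using bs sv.dim_basis[of "set bs"] by (simp add: ordered_bases_def distinct_card)
qed

lemma lin_indep_cancel:
  assumes ind: "lin_indep n bs"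
    and A: "A \<in> carrier_mat (length bs) k" and B: "B \<in> carrier_mat (length bs) k"
    and eq: "mat_of_cols n bs * A = mat_of_cols n bs * B"
  shows "A = B"
proof (rule eq_matI)
  fix i j assume i: "i < dim_row B" and j: "j < dim_col B"
  have M: "mat_of_cols n bs \<in> carrier_mat n (length bs)" by simp
  have "mat_of_cols n bs *\<^sub>v (col A j - col B j) = 0\<^sub>v n"
    using arg_cong[OF eq, of "\<lambda>M. col M j"] A B j
    by (subst mult_minus_distrib_mat_vec[OF M]) (auto simp: col_mult2[OF M])
  then have "col A j - col B j = 0\<^sub>v (length bs)"
    using A B j by (intro lin_indepD[OF ind]) auto
  then have "(col A j - col B j) $ i = 0" using i B by simp
  then show "A $$ (i, j) = B $$ (i, j)" using i j A B by simp
qed (use A B in auto)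

lemma change_of_basis:
  assumes V: "subspace class_ring V (Rn n)"
    and bs: "bs \<in> ordered_bases n V" and cs: "cs \<in> ordered_bases n V"
  obtains A where "length cs = length bs" and "A \<in> carrier_mat (length bs) (length bs)"
    and "det A \<noteq> 0" and "mat_of_cols n cs = mat_of_cols n bs * A"
proof -
  have len: "length cs = length bs"
    using ordered_bases_length[OF V] bs cs by simp
  have bs': "lin_indep n bs" "colspan n bs = V"
    and cs': "set cs \<subseteq> carrier_vec n" "lin_indep n cs" "colspan n cs = V"
    using bs cs ordered_bases_iff[OF V] by auto
  have "\<exists>c\<in>carrier_vec (length bs). cs ! j = mat_of_cols n bs *\<^sub>v c" if "j < length bs" for j
  proof -
    have "cs ! j \<in> colspan n bs"
      using set_subset_colspan[OF cs'(1)] cs'(3) bs'(2) that len by (metis nth_mem subsetD)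
    then show ?thesis by (auto simp: colspan_def)
  qed
  then obtain c where c: "c j \<in> carrier_vec (length bs)" "cs ! j = mat_of_cols n bs *\<^sub>v c j"
    if "j < length bs" for j
    by metis
  define A where "A = mat_of_cols (length bs) (map c [0..<length bs])"
  have A: "A \<in> carrier_mat (length bs) (length bs)"
    using mat_of_cols_carrier(1)[of "length bs" "map c [0..<length bs]"] by (simp add: A_def)
  have M: "mat_of_cols n bs \<in> carrier_mat n (length bs)" by simp
  have eq: "mat_of_cols n cs = mat_of_cols n bs * A"
  proof (rule mat_col_eqI)
    fix j assume "j < dim_col (mat_of_cols n bs * A)"
    then have j: "j < length bs" by (simp add: A_def)
    have "cs ! j \<in> carrier_vec n" using cs'(1) j len by auto
    moreover have col: "col A j = c j" using j c[OF j] by (simp add: A_def)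
    ultimately show "col (mat_of_cols n cs) j = col (mat_of_cols n bs * A) j"
      using j len c[OF j] by (simp add: col_mult2[OF M A j] col)
  qed (use len A in auto)
  have "det A \<noteq> 0"
  proof
    assume "det A = 0"
    then obtain v where v: "v \<in> carrier_vec (length bs)" "v \<noteq> 0\<^sub>v (length bs)" "A *\<^sub>v v = 0\<^sub>v (length bs)"
      using det_0_iff_vec_prod_zero[OF A] by blast
    have "mat_of_cols n cs *\<^sub>v v = 0\<^sub>v n"
      unfolding eq using v A M by (simp add: assoc_mult_mat_vec[OF M A v(1)] mat_of_cols_mult_zero)
    then show False using lin_indepD[OF cs'(2)] v len by auto
  qed
  with that len A eq show ?thesis by blast
qed


section \<open>Orientations and oriented sums\<close>

lemma mat_of_cols_unit_vecs: "mat_of_cols n (unit_vecs n) = (1\<^sub>m n :: real mat)"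
  by (rule eq_matI) (auto simp: mat_of_cols_index unit_vecs_def)

lemma same_orientationI:
  assumes "bs \<in> ordered_bases n V" and "cs \<in> ordered_bases n V"
    and "A \<in> carrier_mat (length bs) (length bs)" and "0 < det A"
    and "mat_of_cols n cs = mat_of_cols n bs * A"
  shows "(bs, cs) \<in> same_orientation n V"
proof -
  have "length cs = length bs" using arg_cong[OF assms(5), of dim_col] assms(3) by simp
  then show ?thesis using assms unfolding same_orientation_def by auto
qed

lemma same_orientationE:
  assumes "(bs, cs) \<in> same_orientation n V"
  obtains A where "bs \<in> ordered_bases n V" and "cs \<in> ordered_bases n V"
    and "length cs = length bs" and "A \<in> carrier_mat (length bs) (length bs)" and "0 < det A"
    and "mat_of_cols n cs = mat_of_cols n bs * A"
proof -
  obtain A where A: "bs \<in> ordered_bases n V" "cs \<in> ordered_bases n V"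
    "A \<in> carrier_mat (length bs) (length cs)" "0 < det A" "mat_of_cols n cs = mat_of_cols n bs * A"
    using assms by (auto simp: same_orientation_def)
  moreover have "length cs = length bs"
    using A(3,4) by (auto simp: det_def split: if_splits)
  ultimately show ?thesis using that by auto
qed

text \<open>The change-of-basis matrix is unique, so the existential quantifier over matrices in
  \<^const>\<open>same_orientation\<close> can be discharged with any of them.\<close>

lemma same_orientation_iff_det:
  assumes V: "subspace class_ring V (Rn n)"
    and bs: "bs \<in> ordered_bases n V" and cs: "cs \<in> ordered_bases n V"
    and A: "A \<in> carrier_mat (length bs) (length bs)"
    and eq: "mat_of_cols n cs = mat_of_cols n bs * A"
  shows "(bs, cs) \<in> same_orientation n V \<longleftrightarrow> 0 < det A"
proof
  assume "(bs, cs) \<in> same_orientation n V"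
  then obtain B where B: "B \<in> carrier_mat (length bs) (length bs)" "0 < det B"
    "mat_of_cols n cs = mat_of_cols n bs * B"
    by (rule same_orientationE)
  then have "A = B"
    using bs ordered_bases_iff[OF V] eq by (intro lin_indep_cancel[OF _ A B(1), of n]) auto
  then show "0 < det A" using B by simp
qed (rule same_orientationI[OF bs cs A _ eq])

lemma same_orientation_equiv:
  assumes V: "subspace class_ring V (Rn n)"
  shows "equiv (ordered_bases n V) (same_orientation n V)"
proof (rule equivI)
  show "same_orientation n V \<subseteq> ordered_bases n V \<times> ordered_bases n V"
    by (auto elim: same_orientationE)
  show "refl_on (ordered_bases n V) (same_orientation n V)"
  proof (rule refl_onI)
    fix bs assume "bs \<in> ordered_bases n V"
    then show "(bs, bs) \<in> same_orientation n V"
      using same_orientationI[of bs n V bs "1\<^sub>m (length bs)"]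
        right_mult_one_mat[OF mat_of_cols_carrier(1), of n bs] by simp
  qed
  show "sym (same_orientation n V)"
  proof (rule symI)
    fix bs cs assume "(bs, cs) \<in> same_orientation n V"
    then obtain A where bs: "bs \<in> ordered_bases n V" and cs: "cs \<in> ordered_bases n V"
      and len: "length cs = length bs"
      and A: "A \<in> carrier_mat (length bs) (length bs)" "0 < det A"
        "mat_of_cols n cs = mat_of_cols n bs * A"
      by (rule same_orientationE)
    obtain B where B: "B \<in> carrier_mat (length bs) (length bs)" "mat_of_cols n bs = mat_of_cols n cs * B"
      using change_of_basis[OF V cs bs] len by metis
    have M: "mat_of_cols n bs \<in> carrier_mat n (length bs)" by simp
    have "mat_of_cols n bs * (A * B) = mat_of_cols n bs * 1\<^sub>m (length bs)"
      using assoc_mult_mat[OF M A(1) B(1)] right_mult_one_mat[OF M] A(3) B(2) by metis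
    then have "A * B = 1\<^sub>m (length bs)"
      using lin_indep_cancel[of n bs "A * B" "length bs" "1\<^sub>m (length bs)"]
        bs ordered_bases_iff[OF V, of bs] A(1) B(1) by simp
    then have "det A * det B = 1" using det_mult[OF A(1) B(1)] by simp
    then have "0 < det B"
      using A(2) zero_less_mult_pos[of "det A" "det B"] by simp
    then show "(cs, bs) \<in> same_orientation n V"
      using same_orientationI[OF cs bs] B len by simp
  qed
  show "trans (same_orientation n V)"
  proof (rule transI)
    fix bs cs ds assume "(bs, cs) \<in> same_orientation n V" and "(cs, ds) \<in> same_orientation n V"
    then obtain A B where bs: "bs \<in> ordered_bases n V" and ds: "ds \<in> ordered_bases n V"
      and A: "A \<in> carrier_mat (length bs) (length bs)" "0 < det A" "mat_of_cols n cs = mat_of_cols n bs * A"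
      and B: "B \<in> carrier_mat (length bs) (length bs)" "0 < det B" "mat_of_cols n ds = mat_of_cols n cs * B"
      by (elim same_orientationE) metis
    have M: "mat_of_cols n bs \<in> carrier_mat n (length bs)" by simp
    show "(bs, ds) \<in> same_orientation n V"
      using A B by (intro same_orientationI[OF bs ds, of "A * B"])
        (auto simp: det_mult assoc_mult_mat[OF M A(1) B(1)])
  qed
qed

lemma oriented_subspacesD:
  assumes "X \<in> oriented_subspaces n"
  shows "subspace class_ring (fst X) (Rn n)"
    and "bs \<in> snd X \<Longrightarrow> bs \<in> ordered_bases n (fst X)"
    and "bs \<in> snd X \<Longrightarrow> cs \<in> snd X \<longleftrightarrow> (bs, cs) \<in> same_orientation n (fst X)"
    and "snd X \<noteq> {}"
proof -
  show V: "subspace class_ring (fst X) (Rn n)"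
    using assms by (auto simp: oriented_subspaces_def)
  have Q: "snd X \<in> ordered_bases n (fst X) // same_orientation n (fst X)"
    using assms by (auto simp: oriented_subspaces_def)
  note E = same_orientation_equiv[OF V]
  show "bs \<in> snd X \<Longrightarrow> bs \<in> ordered_bases n (fst X)"
    using in_quotient_imp_subset[OF E Q] by auto
  show "bs \<in> snd X \<Longrightarrow> cs \<in> snd X \<longleftrightarrow> (bs, cs) \<in> same_orientation n (fst X)"
    using quotient_eq_iff[OF E Q Q] in_quotient_imp_closed[OF E Q] in_quotient_imp_in_rel[OF E Q] by blast
  show "snd X \<noteq> {}"
    using in_quotient_imp_non_empty[OF E Q] .
qed

lemma oriented_subspacesI:
  assumes "subspace class_ring (fst X) (Rn n)" and "bs \<in> ordered_bases n (fst X)"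
    and "snd X = same_orientation n (fst X) `` {bs}"
  shows "X \<in> oriented_subspaces n"
  using assms by (auto simp: oriented_subspaces_def intro: quotientI)

lemma positive_basesE:
  assumes X: "X \<in> oriented_subspaces n" and "bs \<in> snd X" and "cs \<in> snd X"
  obtains A where "length cs = length bs" and "A \<in> carrier_mat (length bs) (length bs)"
    and "0 < det A" and "mat_of_cols n cs = mat_of_cols n bs * A"
  using assms oriented_subspacesD(3)[OF X assms(2)] by (auto elim: same_orientationE)

lemma colspan_append:
  "colspan n (xs @ ys) = LinearCombinations.module.submodule_sum (Rn n) (colspan n xs) (colspan n ys)"
proof -
  interpret vec_space "TYPE(real)" n .
  have "mat_of_cols n (xs @ ys) *\<^sub>v c \<in> submodule_sum (colspan n xs) (colspan n ys)"
    if "c \<in> carrier_vec (length (xs @ ys))" for c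
  proof -
    let ?c = "vec_first c (length xs)" and ?d = "vec_last c (length ys)"
    have "c = ?c @\<^sub>v ?d" using that by (simp add: vec_first_last_append)
    then have "mat_of_cols n (xs @ ys) *\<^sub>v c = mat_of_cols n xs *\<^sub>v ?c + mat_of_cols n ys *\<^sub>v ?d"
      using mat_of_cols_append_mult_vec[of ?c xs ?d ys n] by simp
    then show ?thesis
      by (force simp: submodule_sum_def colspan_def module_vec_simps)
  qed
  moreover have "mat_of_cols n xs *\<^sub>v c + mat_of_cols n ys *\<^sub>v d \<in> colspan n (xs @ ys)"
    if "c \<in> carrier_vec (length xs)" "d \<in> carrier_vec (length ys)" for c d
    using mat_of_cols_append_mult_vec[OF that, of n] that
    by (auto simp: colspan_def intro!: image_eqI[of _ _ "c @\<^sub>v d"])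
  ultimately show ?thesis
    by (auto simp: colspan_def submodule_sum_def module_vec_simps)
qed

lemma zero_vec_append: "0\<^sub>v (m + k) = 0\<^sub>v m @\<^sub>v 0\<^sub>v k"
  by (intro eq_vecI) auto

lemma lin_indep_appendD1:
  assumes "lin_indep n (xs @ ys)"
  shows "lin_indep n xs"
  unfolding lin_indep_def
proof (intro ballI impI)
  fix c assume c: "c \<in> carrier_vec (length xs)" and z: "mat_of_cols n xs *\<^sub>v c = 0\<^sub>v n"
  have "mat_of_cols n (xs @ ys) *\<^sub>v (c @\<^sub>v 0\<^sub>v (length ys)) = 0\<^sub>v n"
    using c z by (subst mat_of_cols_append_mult_vec) auto
  then have "c @\<^sub>v 0\<^sub>v (length ys) = 0\<^sub>v (length (xs @ ys))"
    using c by (intro lin_indepD[OF assms]) auto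
  then have "c @\<^sub>v 0\<^sub>v (length ys) = 0\<^sub>v (length xs) @\<^sub>v 0\<^sub>v (length ys)"
    by (simp only: length_append zero_vec_append)
  then show "c = 0\<^sub>v (length xs)"
    using c by (subst (asm) append_vec_eq) auto
qed

lemma colspan_inter:
  assumes "lin_indep n (xs @ ys)"
  shows "colspan n xs \<inter> colspan n ys = {0\<^sub>v n}"
proof
  show "{0\<^sub>v n} \<subseteq> colspan n xs \<inter> colspan n ys"
    by (simp add: zero_in_colspan)
  show "colspan n xs \<inter> colspan n ys \<subseteq> {0\<^sub>v n}"
  proof
    fix v assume "v \<in> colspan n xs \<inter> colspan n ys"
    then obtain c d where c: "c \<in> carrier_vec (length xs)" "v = mat_of_cols n xs *\<^sub>v c"
      and d: "d \<in> carrier_vec (length ys)" "v = mat_of_cols n ys *\<^sub>v d"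
      by (auto simp: colspan_def)
    have v: "v \<in> carrier_vec n" unfolding c(2) by (intro mult_mat_vec_carrier[OF mat_of_cols_carrier(1) c(1)])
    have "mat_of_cols n ys *\<^sub>v - d = - v"
      unfolding d(2) using d(1) by (intro eq_vecI) (auto simp: scalar_prod_uminus_right)
    then have "mat_of_cols n (xs @ ys) *\<^sub>v (c @\<^sub>v - d) = v + - v"
      using c d by (subst mat_of_cols_append_mult_vec) auto
    then have "c @\<^sub>v - d = 0\<^sub>v (length (xs @ ys))"
      using c d v by (intro lin_indepD[OF assms]) auto
    then have "c @\<^sub>v - d = 0\<^sub>v (length xs) @\<^sub>v 0\<^sub>v (length ys)"
      by (simp only: length_append zero_vec_append)
    then have "c = 0\<^sub>v (length xs)"
      using c by (subst (asm) append_vec_eq) auto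
    then show "v \<in> {0\<^sub>v n}" using c by (simp add: mat_of_cols_mult_zero)
  qed
qed

text \<open>Independence of one concatenation \<open>xs @ ys\<close> of positive bases suffices: any other pair of positive
  bases differs from it by a block diagonal matrix whose determinant is the product of two positive
  ones. The orientation of the sum is therefore the class of \<open>xs @ ys\<close>.\<close>

lemma oriented_sum_of_independent:
  assumes X: "X \<in> oriented_subspaces n" and Y: "Y \<in> oriented_subspaces n"
    and xs: "xs \<in> snd X" and ys: "ys \<in> snd Y" and ind: "lin_indep n (xs @ ys)"
  shows "independent_sum n X Y" and "oriented_sum n X Y \<in> oriented_subspaces n"
    and "xs @ ys \<in> snd (oriented_sum n X Y)"
    and "fst (oriented_sum n X Y) = colspan n (xs @ ys)"
proof -
  have obX: "set xs \<subseteq> carrier_vec n" "colspan n xs = fst X"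
    and obY: "set ys \<subseteq> carrier_vec n" "colspan n ys = fst Y"
    using oriented_subspacesD[OF X] oriented_subspacesD[OF Y] xs ys ordered_bases_iff by blast+
  show "independent_sum n X Y"
    using colspan_inter[OF ind] obX obY by (simp add: independent_sum_def)
  show fst: "fst (oriented_sum n X Y) = colspan n (xs @ ys)"
    using obX obY by (simp add: oriented_sum_def Let_def colspan_append)
  let ?S = "colspan n (xs @ ys)"
  have S: "subspace class_ring ?S (Rn n)"
    using obX obY by (intro subspace_colspan) auto
  have B: "xs @ ys \<in> ordered_bases n ?S"
    using obX obY ind by (simp add: ordered_bases_iff[OF S])
  note E = same_orientation_equiv[OF S]
  have "(xs @ ys, bs @ bs') \<in> same_orientation n ?S" 
    if bs: "bs \<in> snd X" and bs': "bs' \<in> snd Y" and cs: "bs @ bs' \<in> ordered_bases n ?S" for bs bs'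
  proof -
    obtain A where A: "length bs = length xs" "A \<in> carrier_mat (length xs) (length xs)" "0 < det A"
      "mat_of_cols n bs = mat_of_cols n xs * A"
      using positive_basesE[OF X xs bs] .
    obtain A' where A': "length bs' = length ys" "A' \<in> carrier_mat (length ys) (length ys)" "0 < det A'"
      "mat_of_cols n bs' = mat_of_cols n ys * A'"
      using positive_basesE[OF Y ys bs'] .
    let ?B = "four_block_mat A (0\<^sub>m (length xs) (length ys)) (0\<^sub>m (length ys) (length xs)) A'"
    have "mat_of_cols n (bs @ bs') = mat_of_cols n (xs @ ys) * ?B"
      unfolding mat_of_cols_append A A'
      by (subst mult_four_block_mat[of _ n "length xs" _ "length ys" _ 0 _ _ "length xs" _ "length ys"])
        (use A A' in auto)
    moreover have "det ?B = det A * det A'"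
      by (rule det_four_block_mat_lower_left_zero) (use A A' in auto)
    ultimately show ?thesis
      using A A' by (intro same_orientationI[OF B cs, of ?B]) auto
  qed
  note * = this
  have "snd (oriented_sum n X Y) = same_orientation n ?S `` {xs @ ys}"
  proof (intro equalityI subsetI)
    fix cs assume "cs \<in> snd (oriented_sum n X Y)"
    then obtain bs bs' where "bs \<in> snd X" "bs' \<in> snd Y" "(bs @ bs', cs) \<in> same_orientation n ?S"
      using fst by (auto simp: oriented_sum_def Let_def)
    moreover from this have "(xs @ ys, bs @ bs') \<in> same_orientation n ?S"
      by (intro *) (auto elim: same_orientationE)
    ultimately show "cs \<in> same_orientation n ?S `` {xs @ ys}"
      using E by (auto elim!: equivE dest: transD)
  next
    fix cs assume "cs \<in> same_orientation n ?S `` {xs @ ys}"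
    then show "cs \<in> snd (oriented_sum n X Y)"
      using xs ys fst by (auto simp: oriented_sum_def Let_def)
  qed
  then show "oriented_sum n X Y \<in> oriented_subspaces n" "xs @ ys \<in> snd (oriented_sum n X Y)"
    using oriented_subspacesI[of "oriented_sum n X Y" n "xs @ ys"] fst S B E
    by (auto dest: equiv_class_self)
qed

lemma nonzero_cdet_imp_basis:
  assumes vs: "set vs \<subseteq> carrier_vec n" "length vs = n" and d: "cdet n vs \<noteq> 0"
  shows "lin_indep n vs" and "colspan n vs = carrier_vec n"
proof -
  have M: "mat_of_cols n vs \<in> carrier_mat n n"
    using mat_of_cols_carrier(1)[of n vs] vs(2) by simp
  show "lin_indep n vs"
    using det_0_iff_vec_prod_zero[OF M] d vs(2) by (auto simp: lin_indep_def)
  show "colspan n vs = carrier_vec n"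
  proof (intro equalityI subsetI)
    fix b :: "real vec" assume "b \<in> carrier_vec n"
    then obtain x where "x \<in> carrier_vec n" "mat_of_cols n vs *\<^sub>v x = b"
      using nonzero_det_solve[OF M d] by metis
    then show "b \<in> colspan n vs" using vs(2) by (auto simp: colspan_def)
  qed (auto simp: colspan_def intro: mult_mat_vec_carrier[OF mat_of_cols_carrier(1)])
qed

lemma length_unit_vecs: "length (unit_vecs n) = n"
  by (simp add: unit_vecs_def)

lemma unit_vecs_ordered_basis:
  "subspace class_ring (carrier_vec n) (Rn n)" (is ?V)
  "unit_vecs n \<in> ordered_bases n (carrier_vec n)"
proof -
  have car: "set (unit_vecs n :: real vec list) \<subseteq> carrier_vec n" by (rule unit_vecs_carrier)
  have "lin_indep n (unit_vecs n)" "colspan n (unit_vecs n) = carrier_vec n"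
    using nonzero_cdet_imp_basis[OF car] by (simp_all add: mat_of_cols_unit_vecs length_unit_vecs)
  moreover from this(2) show ?V
    using subspace_colspan[OF car] by simp
  ultimately show "unit_vecs n \<in> ordered_bases n (carrier_vec n)"
    using car by (simp add: ordered_bases_iff)
qed

lemma same_orientation_unit_vecs_iff:
  assumes bs: "bs \<in> ordered_bases n (carrier_vec n)"
  shows "(unit_vecs n, bs) \<in> same_orientation n (carrier_vec n) \<longleftrightarrow> 0 < cdet n bs"
proof -
  have "length bs = n"
    using ordered_bases_length[OF unit_vecs_ordered_basis(1)] bs unit_vecs_ordered_basis(2)
    by (metis length_unit_vecs)
  then show ?thesis
    using same_orientation_iff_det[OF unit_vecs_ordered_basis bs, of "mat_of_cols n bs"]
      mat_of_cols_carrier(1)[of n bs]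
    by (simp add: mat_of_cols_unit_vecs length_unit_vecs)
qed

lemma cdet_pos_same_orientation:
  assumes "(bs, cs) \<in> same_orientation n V" and "length (us @ bs @ vs) = n"
  shows "0 < cdet n (us @ cs @ vs) \<longleftrightarrow> 0 < cdet n (us @ bs @ vs)"
  using assms(1)
proof (rule same_orientationE)
  fix A assume "A \<in> carrier_mat (length bs) (length bs)" "0 < det A" "mat_of_cols n cs = mat_of_cols n bs * A"
  then show ?thesis
    using cdet_change_basis[of A bs n cs us vs] assms(2) by (simp add: zero_less_mult_iff)
qed

lemma positive_basis_spans:
  assumes X: "X \<in> oriented_subspaces n" and "bs \<in> snd X"
  shows "set bs \<subseteq> carrier_vec n" and "lin_indep n bs" and "colspan n bs = fst X"
  using oriented_subspacesD(2)[OF assms] ordered_bases_iff[OF oriented_subspacesD(1)[OF X]] by auto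

text \<open>The bridge from oriented subspaces to determinants. From left to right, the standard basis is
  positive for the sum; unfolding the two sums yields positive bases of the summands whose
  concatenation has positive determinant, and these may be exchanged for the given ones. From right to
  left, a nonzero determinant makes every initial part of the concatenation independent, so both sums
  are direct and are oriented by the concatenated bases.\<close>

lemma oriented_triple_sum_iff:
  assumes X: "X \<in> oriented_subspaces n" and Y: "Y \<in> oriented_subspaces n" and Z: "Z \<in> oriented_subspaces n"
    and xs: "xs \<in> snd X" and ys: "ys \<in> snd Y" and zs: "zs \<in> snd Z"
    and len: "length xs + length ys + length zs = n"
  shows "(independent_sum n X Y \<and> independent_sum n (oriented_sum n X Y) Z \<and>
           oriented_sum n (oriented_sum n X Y) Z = standard_oriented_Rn n)
         \<longleftrightarrow> 0 < cdet n (xs @ ys @ zs)" (is "?L \<longleftrightarrow> _")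
proof
  let ?W = "oriented_sum n X Y" and ?C = "carrier_vec n :: real vec set"
  note E = same_orientation_equiv[OF unit_vecs_ordered_basis(1)]
  {
    assume ?L
    then have st: "oriented_sum n ?W Z = standard_oriented_Rn n" by simp
    have "unit_vecs n \<in> snd (standard_oriented_Rn n)"
      using equiv_class_self[OF E unit_vecs_ordered_basis(2)] by (simp add: standard_oriented_Rn_def)
    then obtain bs zs' where bs: "bs \<in> snd ?W" and zs': "zs' \<in> snd Z"
      and "(bs @ zs', unit_vecs n) \<in> same_orientation n (fst (oriented_sum n ?W Z))"
      unfolding st[symmetric] by (auto simp: oriented_sum_def Let_def)
    then have so: "(bs @ zs', unit_vecs n) \<in> same_orientation n ?C"
      unfolding st by (simp add: standard_oriented_Rn_def)
    have len': "length (bs @ zs') = n"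
      using same_orientationE[OF so] by (metis length_unit_vecs)
    have pos: "0 < cdet n (bs @ zs')"
      using cdet_pos_same_orientation[OF so, of "[]" "[]"] len' by (simp add: mat_of_cols_unit_vecs)
    obtain xs' ys' where xs': "xs' \<in> snd X" and ys': "ys' \<in> snd Y"
      and so': "(xs' @ ys', bs) \<in> same_orientation n (fst ?W)"
      using bs by (auto simp: oriented_sum_def Let_def)
    have lx: "(xs, xs') \<in> same_orientation n (fst X)" and ly: "(ys, ys') \<in> same_orientation n (fst Y)"
      and lz: "(zs, zs') \<in> same_orientation n (fst Z)"
      using oriented_subspacesD(3)[OF X xs] oriented_subspacesD(3)[OF Y ys]
        oriented_subspacesD(3)[OF Z zs] xs' ys' zs' by auto
    have l: "length xs' = length xs" "length ys' = length ys" "length zs' = length zs"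
      using lx ly lz by (auto elim!: same_orientationE)
    have "0 < cdet n (xs' @ ys' @ zs')"
      using cdet_pos_same_orientation[OF so', of "[]" zs'] pos l len by simp
    then have "0 < cdet n (xs' @ ys' @ zs)"
      using cdet_pos_same_orientation[OF lz, of "xs' @ ys'" "[]"] l len by simp
    then have "0 < cdet n (xs' @ ys @ zs)"
      using cdet_pos_same_orientation[OF ly, of xs' zs] l len by simp
    then show "0 < cdet n (xs @ ys @ zs)"
      using cdet_pos_same_orientation[OF lx, of "[]" "ys @ zs"] l len by simp
  next
    assume pos: "0 < cdet n (xs @ ys @ zs)"
    have car: "set xs \<subseteq> carrier_vec n" "set ys \<subseteq> carrier_vec n" "set zs \<subseteq> carrier_vec n"
      using positive_basis_spans[OF X xs] positive_basis_spans[OF Y ys] positive_basis_spans[OF Z zs]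
      by simp_all
    have li: "lin_indep n ((xs @ ys) @ zs)" and sp: "colspan n ((xs @ ys) @ zs) = carrier_vec n"
      using nonzero_cdet_imp_basis[of "xs @ ys @ zs" n] car len pos by simp_all
    note W = oriented_sum_of_independent[OF X Y xs ys lin_indep_appendD1[OF li]]
    note T = oriented_sum_of_independent[OF W(2) Z W(3) zs li]
    let ?T = "oriented_sum n ?W Z"
    have fstT: "fst ?T = ?C" using T(4) sp by simp
    have T3: "xs @ ys @ zs \<in> snd ?T" using T(3) by simp
    have "xs @ ys @ zs \<in> ordered_bases n ?C"
      using oriented_subspacesD(2)[OF T(2) T3] fstT by simp
    then have "(unit_vecs n, xs @ ys @ zs) \<in> same_orientation n ?C"
      using same_orientation_unit_vecs_iff pos by simp
    then have "same_orientation n ?C `` {unit_vecs n} = same_orientation n ?C `` {xs @ ys @ zs}"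
      by (rule equiv_class_eq[OF E])
    also have "\<dots> = snd ?T"
      using oriented_subspacesD(3)[OF T(2) T3] fstT by auto
    finally have "?T = standard_oriented_Rn n"
      using fstT by (simp add: standard_oriented_Rn_def prod_eq_iff)
    then show ?L using W(1) T(1) by simp
  }
qed

lemma ordered_bases_transform:
  assumes V: "subspace class_ring V (Rn n)" and bs: "bs \<in> ordered_bases n V"
    and cs: "set cs \<subseteq> carrier_vec n" and A: "A \<in> carrier_mat (length bs) (length bs)"
    and d: "det A \<noteq> 0" and eq: "mat_of_cols n cs = mat_of_cols n bs * A"
  shows "cs \<in> ordered_bases n V"
proof -
  have len: "length cs = length bs" using arg_cong[OF eq, of dim_col] A by simp
  have M: "mat_of_cols n bs \<in> carrier_mat n (length bs)" by simp
  have li: "lin_indep n bs" and sp: "colspan n bs = V"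
    using bs ordered_bases_iff[OF V] by auto
  have mult: "mat_of_cols n cs *\<^sub>v c = mat_of_cols n bs *\<^sub>v (A *\<^sub>v c)"
    if "c \<in> carrier_vec (length bs)" for c
    unfolding eq by (rule assoc_mult_mat_vec[OF M A that])
  have "lin_indep n cs"
    unfolding lin_indep_def
  proof (intro ballI impI)
    fix c assume c: "c \<in> carrier_vec (length cs)" and z: "mat_of_cols n cs *\<^sub>v c = 0\<^sub>v n"
    have "A *\<^sub>v c = 0\<^sub>v (length bs)"
      using c z A len mult by (intro lin_indepD[OF li]) auto
    then show "c = 0\<^sub>v (length cs)"
      using det_0_iff_vec_prod_zero[OF A] d c len by auto
  qed
  moreover have "colspan n cs = V"
  proof (intro equalityI subsetI)
    fix v assume "v \<in> colspan n cs"
    then show "v \<in> V"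
      using A mult len by (auto simp: colspan_def simp flip: sp)
  next
    fix v assume "v \<in> V"
    then obtain c where c: "c \<in> carrier_vec (length bs)" "v = mat_of_cols n bs *\<^sub>v c"
      by (auto simp: colspan_def simp flip: sp)
    obtain x where "x \<in> carrier_vec (length bs)" "A *\<^sub>v x = c"
      using nonzero_det_solve[OF A d c(1)] .
    then show "v \<in> colspan n cs"
      using c mult[of x] len unfolding colspan_def by (metis image_eqI)
  qed
  ultimately show ?thesis using cs by (simp add: ordered_bases_iff[OF V])
qed

lemma extend_to_ordered_basis:
  assumes V: "subspace class_ring V (Rn n)" and cs: "cs \<in> ordered_bases n V"
    and len: "length cs = Suc (length bs)" and li: "lin_indep n bs" and sub: "set bs \<subseteq> V"
  obtains v where "v \<in> V" and "bs @ [v] \<in> ordered_bases n V"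
proof -
  interpret vec_space "TYPE(real)" n .
  interpret sv: vectorspace class_ring "sub_vs n V" by (rule subspace_vectorspace(1)[OF V])
  have carV: "V \<subseteq> carrier_vec n" by (rule subspace_vectorspace(2)[OF V])
  have car: "set bs \<subseteq> carrier_vec n" using sub carV by auto
  have "colspan n bs \<noteq> V"
    using ordered_bases_iff[OF V, of bs] car li ordered_bases_length[OF V, of bs]
      ordered_bases_length[OF V cs] len by auto
  then obtain v where v: "v \<in> V" "v \<notin> span (set bs)"
    using colspan_subset[OF V sub] colspan_eq_span[OF car] by auto
  have vbs: "v \<notin> set bs" using v(2) in_own_span[OF car] by auto
  have "distinct bs" and "\<not> lin_dep (set bs)"
    using li lin_indep_iff[OF car] by auto
  then have "distinct (bs @ [v])" and "\<not> lin_dep (set (bs @ [v]))"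
    using vbs lin_dep_iff_in_span[of "set bs" v] car v carV by auto
  moreover have "set (bs @ [v]) \<subseteq> V" using sub v by simp
  ultimately have "bs @ [v] \<in> ordered_bases n V"
    using sv.dim_li_is_basis[of "set (bs @ [v])"] span_li_not_depend(2)[of "set (bs @ [v])" V]
      V cs len ordered_bases_length[OF V cs]
    by (auto simp: ordered_bases_def sv.basis_def sv.fin_dim_def subspace_def distinct_card)
  with v that show ?thesis by blast
qed


section \<open>Positive triples of frames\<close>

definition positive_triple where
  "positive_triple n f g h \<longleftrightarrow>
     (\<forall>i<n. \<forall>j<n. \<forall>k<n. i + j + k = n \<longrightarrow>
        0 < cdet n (map f [0..<i] @ map g [0..<j] @ map h [0..<k]))"

lemma positive_tripleD:
  "positive_triple n f g h \<Longrightarrow> i < n \<Longrightarrow> j < n \<Longrightarrow> k < n \<Longrightarrow> i + j + k = n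
    \<Longrightarrow> 0 < cdet n (map f [0..<i] @ map g [0..<j] @ map h [0..<k])"
  by (simp add: positive_triple_def)

lemma cdet_move_two_last:
  assumes "length (P @ Q @ R) + 2 = n"
  shows "cdet n (P @ [x] @ Q @ [y] @ R) = (- 1) ^ length Q * cdet n (P @ Q @ R @ [x, y])"
  using cdet_swap_blocks[of P "[x]" Q "[y] @ R" n] cdet_swap_blocks[of "P @ Q" "[x, y]" R "[]" n] assms
  by simp

text \<open>The relation for vectors that sit at the ends of four blocks instead of at the end of the whole
  list. Moving them there changes each of the three products by the same sign.\<close>

lemma pluecker_relation_blocks:
  assumes len: "length (U @ V @ W @ T) + 2 = n"
    and car: "a \<in> carrier_vec n" "b \<in> carrier_vec n" "c \<in> carrier_vec n" "d \<in> carrier_vec n"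
    and ac: "cdet n ((U @ [a]) @ V @ (W @ [c]) @ T) \<noteq> 0"
  shows "cdet n ((U @ [a]) @ V @ (W @ [c]) @ T) * cdet n (U @ (V @ [b]) @ W @ (T @ [d])) =
         cdet n ((U @ [a]) @ V @ W @ (T @ [d])) * cdet n (U @ (V @ [b]) @ (W @ [c]) @ T) +
         cdet n ((U @ [a]) @ (V @ [b]) @ W @ T) * cdet n (U @ V @ (W @ [c]) @ (T @ [d]))"
proof -
  define L where "L = U @ V @ W @ T"
  define j k l where jkl: "j = length V" "k = length W" "l = length T"
  have ac': "cdet n ((U @ [a]) @ V @ (W @ [c]) @ T) = (- 1) ^ (j + k) * cdet n (L @ [a, c])"
    using cdet_move_two_last[of U "V @ W" T n a c] len by (simp add: L_def jkl)
  have bd: "cdet n (U @ (V @ [b]) @ W @ (T @ [d])) = (- 1) ^ (k + l) * cdet n (L @ [b, d])"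
    using cdet_move_two_last[of "U @ V" "W @ T" "[]" n b d] len by (simp add: L_def jkl)
  have ad: "cdet n ((U @ [a]) @ V @ W @ (T @ [d])) = (- 1) ^ (j + k + l) * cdet n (L @ [a, d])"
    using cdet_move_two_last[of U "V @ W @ T" "[]" n a d] len by (simp add: L_def jkl add.assoc)
  have bc: "cdet n (U @ (V @ [b]) @ (W @ [c]) @ T) = (- 1) ^ k * cdet n (L @ [b, c])"
    using cdet_move_two_last[of "U @ V" W T n b c] len by (simp add: L_def jkl)
  have ab: "cdet n ((U @ [a]) @ (V @ [b]) @ W @ T) = (- 1) ^ j * cdet n (L @ [a, b])"
    using cdet_move_two_last[of U V "W @ T" n a b] len by (simp add: L_def jkl)
  have cd: "cdet n (U @ V @ (W @ [c]) @ (T @ [d])) = (- 1) ^ l * cdet n (L @ [c, d])"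
    using cdet_move_two_last[of "U @ V @ W" T "[]" n c d] len by (simp add: L_def jkl)
  have "cdet n (L @ [a, c]) \<noteq> 0" using ac unfolding ac' by auto
  then have rel: "cdet n (L @ [a, c]) * cdet n (L @ [b, d]) =
      cdet n (L @ [a, d]) * cdet n (L @ [b, c]) + cdet n (L @ [a, b]) * cdet n (L @ [c, d])"
    using len car by (intro pluecker_relation[of L "n - 2"]) (auto simp: L_def)
  have "cdet n ((U @ [a]) @ V @ (W @ [c]) @ T) * cdet n (U @ (V @ [b]) @ W @ (T @ [d])) =
      (- 1) ^ (j + l) * (cdet n (L @ [a, c]) * cdet n (L @ [b, d]))"
    unfolding ac' bd by (simp add: minus_one_power_iff)
  also have "\<dots> = (- 1) ^ (j + l) * (cdet n (L @ [a, d]) * cdet n (L @ [b, c]))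
      + (- 1) ^ (j + l) * (cdet n (L @ [a, b]) * cdet n (L @ [c, d]))"
    unfolding rel by (rule distrib_left)
  also have "\<dots> = ((- 1) ^ (j + k + l) * cdet n (L @ [a, d])) * ((- 1) ^ k * cdet n (L @ [b, c]))
      + ((- 1) ^ j * cdet n (L @ [a, b])) * ((- 1) ^ l * cdet n (L @ [c, d]))"
    by (simp add: minus_one_power_iff)
  finally show ?thesis unfolding ad bc ab cd .
qed

text \<open>The heart of the proof. The conclusion is strengthened from triples to quadruples so that it can be
  proved by induction on \<open>j + l\<close>: the cases \<open>l = 0\<close> and \<open>j = 0\<close> are the two hypotheses. Otherwise the
  Pluecker relation for the last vectors of the \<open>b\<close> and \<open>d\<close> blocks and the next vectors of the \<open>a\<close>
  and \<open>c\<close> blocks expresses the determinant as a quotient: a sum of two products, over a single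
  determinant, with \<open>j + l\<close> smaller in all five of them. Every index tuple involved has two positive
  entries besides summing to \<open>n\<close>, which keeps all indices below \<open>n\<close>.\<close>

lemma positive_quadruple:
  fixes a b c d :: "nat \<Rightarrow> real vec"
  assumes abc: "positive_triple n a b c" and acd: "positive_triple n a c d"
    and car: "\<And>i. a i \<in> carrier_vec n" "\<And>i. b i \<in> carrier_vec n"
      "\<And>i. c i \<in> carrier_vec n" "\<And>i. d i \<in> carrier_vec n"
  shows "i < n \<Longrightarrow> j < n \<Longrightarrow> k < n \<Longrightarrow> l < n \<Longrightarrow> i + j + k + l = n \<Longrightarrow>
    0 < cdet n (map a [0..<i] @ map b [0..<j] @ map c [0..<k] @ map d [0..<l])"
proof (induction "j + l" arbitrary: i j k l rule: less_induct)
  case less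
  let ?Q = "\<lambda>i j k l. cdet n (map a [0..<i] @ map b [0..<j] @ map c [0..<k] @ map d [0..<l])"
  consider "l = 0" | "j = 0" | j' l' where "j = Suc j'" "l = Suc l'"
    by (cases j; cases l) auto
  then show ?case
  proof cases
    case 1
    then show ?thesis using positive_tripleD[OF abc, of i j k] less.prems by simp
  next
    case 2
    then show ?thesis using positive_tripleD[OF acd, of i k l] less.prems by simp
  next
    case 3
    have ac: "0 < ?Q (Suc i) j' (Suc k) l'" and ad: "0 < ?Q (Suc i) j' k (Suc l')"
      and bc: "0 < ?Q i (Suc j') (Suc k) l'" and ab: "0 < ?Q (Suc i) (Suc j') k l'"
      and cd: "0 < ?Q i j' (Suc k) (Suc l')"
      using less.prems 3 by (intro less.hyps; simp)+
    have "?Q (Suc i) j' (Suc k) l' * ?Q i j k l =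
        ?Q (Suc i) j' k (Suc l') * ?Q i (Suc j') (Suc k) l' +
        ?Q (Suc i) (Suc j') k l' * ?Q i j' (Suc k) (Suc l')"
      using pluecker_relation_blocks[of "map a [0..<i]" "map b [0..<j']" "map c [0..<k]" "map d [0..<l']" n
          "a i" "b j'" "c k" "d l'"] ac less.prems 3 car by simp
    then have "0 < ?Q (Suc i) j' (Suc k) l' * ?Q i j k l"
      using ad bc ab cd by (simp add: add_pos_pos)
    then show ?thesis using ac by (simp add: zero_less_mult_iff)
  qed
qed

lemma positive_triple_transitive:
  fixes a b c d :: "nat \<Rightarrow> real vec"
  assumes "positive_triple n a b c" and "positive_triple n a c d"
    and "\<And>i. a i \<in> carrier_vec n" "\<And>i. b i \<in> carrier_vec n"
      "\<And>i. c i \<in> carrier_vec n" "\<And>i. d i \<in> carrier_vec n"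
  shows "positive_triple n a b d"
  unfolding positive_triple_def
  using positive_quadruple[OF assms, where k = 0] by auto

definition signed :: "real \<Rightarrow> (nat \<Rightarrow> real vec) \<Rightarrow> nat \<Rightarrow> real vec" where
  "signed s f = (\<lambda>i. s \<cdot>\<^sub>v f i)"

lemma mat_of_cols_signed:
  assumes "\<And>p. p < i \<Longrightarrow> f p \<in> carrier_vec n"
  shows "mat_of_cols n (map (signed s f) [0..<i]) = mat_of_cols n (map f [0..<i]) * (s \<cdot>\<^sub>m 1\<^sub>m i)"
proof -
  have "mat_of_cols n (map f [0..<i]) \<in> carrier_mat n i"
    using mat_of_cols_carrier(1)[of n "map f [0..<i]"] by simp
  then have "mat_of_cols n (map f [0..<i]) * (s \<cdot>\<^sub>m 1\<^sub>m i) = s \<cdot>\<^sub>m mat_of_cols n (map f [0..<i])"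
    by (subst mult_smult_distrib) auto
  also have "\<dots> = mat_of_cols n (map (signed s f) [0..<i])"
    using assms[THEN carrier_vecD] by (intro eq_matI) (auto simp: mat_of_cols_index signed_def)
  finally show ?thesis ..
qed

lemma cdet_signed:
  assumes car: "\<And>i. f i \<in> carrier_vec n" "\<And>i. g i \<in> carrier_vec n" "\<And>i. h i \<in> carrier_vec n"
    and n: "i + j + k = n"
  shows "cdet n (map (signed s f) [0..<i] @ map (signed t g) [0..<j] @ map (signed u h) [0..<k]) =
         s ^ i * t ^ j * u ^ k * cdet n (map f [0..<i] @ map g [0..<j] @ map h [0..<k])"
proof -
  have ch: "cdet n (us @ map (signed r e) [0..<p] @ vs) = r ^ p * cdet n (us @ map e [0..<p] @ vs)"
    if "\<And>i. e i \<in> carrier_vec n" "length us + p + length vs = n" for us vs e p r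
    using cdet_change_basis[of "r \<cdot>\<^sub>m 1\<^sub>m p" "map e [0..<p]" n "map (signed r e) [0..<p]" us vs]
      mat_of_cols_signed[of p e n r] that by simp
  show ?thesis
    using ch[of f "[]" i "map (signed t g) [0..<j] @ map (signed u h) [0..<k]" s]
      ch[of g "map f [0..<i]" j "map (signed u h) [0..<k]" t]
      ch[of h "map f [0..<i] @ map g [0..<j]" k "[]" u] car n
    by (simp add: mult.assoc)
qed

lemma signed_simps [simp]: "signed 1 f = f" "signed s (signed t f) = signed (s * t) f"
  "signed s f i \<in> carrier_vec n \<longleftrightarrow> f i \<in> carrier_vec n"
  by (auto simp: signed_def smult_smult_assoc)


section \<open>Signs of the lifts\<close>

definition lift_signs :: "nat \<Rightarrow> real set" where
  "lift_signs n = (if even n then {1, - 1} else {1})"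

lemma lift_signs_cases:
  assumes "s \<in> lift_signs n"
  shows "s = 1 \<or> even n \<and> s = - 1"
  using assms by (auto simp: lift_signs_def split: if_splits)

text \<open>Moving the first block, of length \<open>i\<close>, to the end costs the sign \<open>(- 1)\<^bsup>i (n - i)\<^esup>\<close>. For odd
  \<open>n\<close> this is \<open>1\<close>; for even \<open>n\<close> it is \<open>(- 1)\<^sup>i\<close>, which is compensated by the other lift of the
  moved flag.\<close>

lemma positive_triple_rotate:
  assumes p: "positive_triple n f g h"
    and car: "\<And>i. f i \<in> carrier_vec n" "\<And>i. g i \<in> carrier_vec n" "\<And>i. h i \<in> carrier_vec n"
  shows "positive_triple n g h (signed (if even n then - 1 else 1) f)"
  unfolding positive_triple_def
proof (intro allI impI)
  let ?r = "if even n then - 1 else 1 :: real"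
  fix j k i assume lt: "j < n" "k < n" "i < n" and sum: "j + k + i = n"
  have "cdet n (map g [0..<j] @ map h [0..<k] @ map (signed ?r f) [0..<i]) =
      ?r ^ i * cdet n (map g [0..<j] @ map h [0..<k] @ map f [0..<i])"
    using cdet_signed[of g n h f j k i 1 1 ?r] car sum by (simp del: signed_simps(2))
  also have "cdet n (map g [0..<j] @ map h [0..<k] @ map f [0..<i]) =
      (- 1) ^ ((j + k) * i) * cdet n (map f [0..<i] @ map g [0..<j] @ map h [0..<k])"
    using cdet_swap_initial_blocks[of "map g [0..<j] @ map h [0..<k]" "map f [0..<i]" "[]" n] sum by simp
  also have "?r ^ i * ((- 1) ^ ((j + k) * i) * cdet n (map f [0..<i] @ map g [0..<j] @ map h [0..<k])) =
      cdet n (map f [0..<i] @ map g [0..<j] @ map h [0..<k])"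
    using sum by (auto simp: minus_one_power_iff)
  also have "0 < \<dots>"
    using positive_tripleD[OF p, of i j k] lt sum by simp
  finally show "0 < cdet n (map g [0..<j] @ map h [0..<k] @ map (signed ?r f) [0..<i])" .
qed

text \<open>Reversing the order of the blocks costs \<open>(- 1)\<^bsup>i j + i k + j k\<^esup>\<close>, which is \<open>- 1\<close> for
  \<open>(1, 1, n - 2)\<close> and its permutations. For odd \<open>n\<close> this contradicts positivity at once. For even
  \<open>n\<close> a change of lifts would have to satisfy \<open>s t < 0\<close>, \<open>s u < 0\<close> and \<open>t u < 0\<close>, and the product of
  these three numbers is a square.\<close>

lemma positive_triple_not_reversed:
  assumes p: "positive_triple n f g h"
    and q: "positive_triple n (signed u h) (signed t g) (signed s f)"
    and signs: "s \<in> lift_signs n" "t \<in> lift_signs n" "u \<in> lift_signs n" and n: "n \<ge> 2"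
    and car: "\<And>i. f i \<in> carrier_vec n" "\<And>i. g i \<in> carrier_vec n" "\<And>i. h i \<in> carrier_vec n"
  shows False
proof -
  have sgn: "0 < s ^ i * t ^ j * u ^ k * (- 1) ^ (i * j + i * k + j * k)"
    if lt: "i < n" "j < n" "k < n" and sum: "i + j + k = n" for i j k
  proof -
    let ?X = "map f [0..<i]" and ?Y = "map g [0..<j]" and ?Z = "map h [0..<k]"
    have "0 < cdet n (map (signed u h) [0..<k] @ map (signed t g) [0..<j] @ map (signed s f) [0..<i])"
      using positive_tripleD[OF q, of k j i] lt sum by simp
    also have "\<dots> = u ^ k * t ^ j * s ^ i * cdet n (?Z @ ?Y @ ?X)"
      by (rule cdet_signed) (use car sum in auto)
    also have "cdet n (?Z @ ?Y @ ?X) = (- 1) ^ (k * (j + i)) * cdet n (?Y @ ?X @ ?Z)"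
      using cdet_swap_initial_blocks[of ?Z "?Y @ ?X" "[]" n] sum by (simp add: add.commute)
    also have "cdet n (?Y @ ?X @ ?Z) = (- 1) ^ (j * i) * cdet n (?X @ ?Y @ ?Z)"
      using cdet_swap_initial_blocks[of ?Y ?X ?Z n] sum by simp
    finally have "0 < (s ^ i * t ^ j * u ^ k * (- 1) ^ (i * j + i * k + j * k)) * cdet n (?X @ ?Y @ ?Z)"
      by (simp add: power_add algebra_simps)
    then show ?thesis
      using positive_tripleD[OF p lt sum] by (simp add: zero_less_mult_iff)
  qed
  obtain m where m: "n = m + 2" using n by (metis add.commute le_Suc_ex)
  show False
    using sgn[of 1 1 m] sgn[of 1 m 1] sgn[of m 1 1] signs[THEN lift_signs_cases]
    by (auto simp: m)
qed

lemma positive_triple_signed_all: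
  assumes p: "positive_triple n f g h" and r: "r \<in> lift_signs n"
    and car: "\<And>i. f i \<in> carrier_vec n" "\<And>i. g i \<in> carrier_vec n" "\<And>i. h i \<in> carrier_vec n"
  shows "positive_triple n (signed r f) (signed r g) (signed r h)"
  unfolding positive_triple_def
proof (intro allI impI)
  fix i j k assume lt: "i < n" "j < n" "k < n" and sum: "i + j + k = n"
  have "r ^ i * r ^ j * r ^ k = 1"
    using lift_signs_cases[OF r] sum by (auto simp flip: power_add)
  then show "0 < cdet n (map (signed r f) [0..<i] @ map (signed r g) [0..<j] @ map (signed r h) [0..<k])"
    using cdet_signed[of f n g h i j k r r r] car sum positive_tripleD[OF p lt sum] by simp
qed

text \<open>The lift of \<open>c\<close> is determined by that of \<open>a\<close>: the sign enters the determinant of \<open>a\<^sup>(\<^sup>1\<^sup>)\<close> and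
  \<open>c\<^sup>(\<^sup>n\<^sup>-\<^sup>1\<^sup>)\<close> with exponent \<open>n - 1\<close>, which is odd when there is a choice of lift at all.\<close>

lemma positive_triple_middle_sign_unique:
  assumes p: "positive_triple n a b (signed u c)" and q: "positive_triple n a (signed w c) d"
    and signs: "u \<in> lift_signs n" "w \<in> lift_signs n" and n: "n \<ge> 2"
    and car: "\<And>i. a i \<in> carrier_vec n" "\<And>i. c i \<in> carrier_vec n"
  shows "u = w"
proof -
  have "0 < u ^ (n - 1) * cdet n (map a [0..<1] @ map c [0..<n-1])"
    using positive_tripleD[OF p, of 1 0 "n - 1"] n
      cdet_signed[of a n a c 1 0 "n - 1" 1 1 u] car by simp
  moreover have "0 < w ^ (n - 1) * cdet n (map a [0..<1] @ map c [0..<n-1])"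
    using positive_tripleD[OF q, of 1 "n - 1" 0] n
      cdet_signed[of a n c a 1 "n - 1" 0 1 w 1] car by simp
  ultimately show ?thesis
    using signs[THEN lift_signs_cases] n by (auto simp: zero_less_mult_iff)
qed

lemma lift_signs_mult: "s \<in> lift_signs n \<Longrightarrow> t \<in> lift_signs n \<Longrightarrow> s * t \<in> lift_signs n"
  by (auto simp: lift_signs_def split: if_splits)

text \<open>The two hypotheses may use different lifts of \<open>a\<close> and \<open>c\<close>. Changing all three lifts of the second
  triple by \<open>s * s'\<close> makes the lifts of \<open>a\<close> agree, and then those of \<open>c\<close> agree as well.\<close>

lemma signed_positive_triple_transitive:
  assumes p: "positive_triple n (signed s a) (signed t b) (signed u c)"
    and q: "positive_triple n (signed s' a) (signed u' c) (signed v d)"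
    and signs: "s \<in> lift_signs n" "u \<in> lift_signs n" "s' \<in> lift_signs n" "u' \<in> lift_signs n" and n: "n \<ge> 2"
    and car: "\<And>i. a i \<in> carrier_vec n" "\<And>i. b i \<in> carrier_vec n"
      "\<And>i. c i \<in> carrier_vec n" "\<And>i. d i \<in> carrier_vec n"
  shows "positive_triple n (signed s a) (signed t b) (signed (s * s' * v) d)"
proof -
  have "s' * s' = 1" using lift_signs_cases[OF signs(3)] by auto
  then have q': "positive_triple n (signed s a) (signed (s * s' * u') c) (signed (s * s' * v) d)"
    using positive_triple_signed_all[OF q lift_signs_mult[OF signs(1,3)]] car
    by (simp add: mult.assoc)
  have "u = s * s' * u'"
    using positive_triple_middle_sign_unique[OF p q'] signs n car by (simp add: lift_signs_mult)
  then show ?thesis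
    using positive_triple_transitive[OF p, of "signed (s * s' * v) d"] q' car by simp
qed


section \<open>Frames of oriented flags\<close>

text \<open>A subspace has only two orientations because the determinant of a change of basis is either
  positive or negative; a basis obtained with a negative determinant represents the other one.\<close>

lemma det_negative_reverse_orientation:
  assumes X: "X \<in> oriented_subspaces n" and bs: "bs \<in> snd X"
    and cs: "set cs \<subseteq> carrier_vec n" and A: "A \<in> carrier_mat (length bs) (length bs)"
    and d: "det A < 0" and eq: "mat_of_cols n cs = mat_of_cols n bs * A"
  shows "reverse_orientation n X \<in> oriented_subspaces n" and "cs \<in> snd (reverse_orientation n X)"
proof -
  note V = oriented_subspacesD(1)[OF X]
  have bsO: "bs \<in> ordered_bases n (fst X)" by (rule oriented_subspacesD(2)[OF X bs])
  have csO: "cs \<in> ordered_bases n (fst X)"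
    using ordered_bases_transform[OF V bsO cs A _ eq] d by simp
  have lcs: "length cs = length bs" using arg_cong[OF eq, of dim_col] A by simp
  note E = same_orientation_equiv[OF V]
  have "(cs, ds) \<in> same_orientation n (fst X) \<longleftrightarrow> (bs, ds) \<notin> same_orientation n (fst X)"
    if ds: "ds \<in> ordered_bases n (fst X)" for ds
  proof -
    obtain C where C: "C \<in> carrier_mat (length bs) (length bs)" "det C \<noteq> 0" "mat_of_cols n ds = mat_of_cols n cs * C"
      using change_of_basis[OF V csO ds] lcs by metis
    have M: "mat_of_cols n bs \<in> carrier_mat n (length bs)" by simp
    have "mat_of_cols n ds = mat_of_cols n bs * (A * C)"
      unfolding C(3) eq by (rule assoc_mult_mat[OF M A C(1)])
    then have "(bs, ds) \<in> same_orientation n (fst X) \<longleftrightarrow> 0 < det (A * C)"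
      using A C by (intro same_orientation_iff_det[OF V bsO ds]) auto
    moreover have "(cs, ds) \<in> same_orientation n (fst X) \<longleftrightarrow> 0 < det C"
      using C lcs by (intro same_orientation_iff_det[OF V csO ds]) auto
    ultimately show ?thesis
      using d C(2) by (auto simp: det_mult[OF A C(1)] zero_less_mult_iff)
  qed
  then have snd: "snd (reverse_orientation n X) = same_orientation n (fst X) `` {cs}"
    using oriented_subspacesD(3)[OF X bs]
    by (auto simp: reverse_orientation_def elim: same_orientationE)
  then show "reverse_orientation n X \<in> oriented_subspaces n"
    using oriented_subspacesI[of "reverse_orientation n X" n cs] V csO
    by (simp add: reverse_orientation_def)
  show "cs \<in> snd (reverse_orientation n X)"
    using snd equiv_class_self[OF E csO] by simp
qed

lemma det_positive_same_orientation:
  assumes X: "X \<in> oriented_subspaces n" and bs: "bs \<in> snd X"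
    and cs: "set cs \<subseteq> carrier_vec n" and A: "A \<in> carrier_mat (length bs) (length bs)"
    and d: "0 < det A" and eq: "mat_of_cols n cs = mat_of_cols n bs * A"
  shows "cs \<in> snd X"
proof -
  note V = oriented_subspacesD(1)[OF X]
  have bsO: "bs \<in> ordered_bases n (fst X)" by (rule oriented_subspacesD(2)[OF X bs])
  have "cs \<in> ordered_bases n (fst X)"
    using ordered_bases_transform[OF V bsO cs A _ eq] d by simp
  then show ?thesis
    using same_orientationI[OF bsO _ A d eq] oriented_subspacesD(3)[OF X bs] by simp
qed

lemma oriented_zero_space: "({0\<^sub>v n}, {[]}) \<in> oriented_subspaces n"
proof -
  have "carrier_vec 0 = {0\<^sub>v 0 :: real vec}"
    by (auto intro: eq_vecI)
  then have sp: "colspan n [] = {0\<^sub>v n}"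
    using mat_of_cols_mult_zero[of n "[]"] by (simp add: colspan_def)
  have V: "subspace class_ring {0\<^sub>v n} (Rn n)"
    using subspace_colspan[of "[]" n] sp by simp
  have e: "[] \<in> ordered_bases n {0\<^sub>v n}"
    using sp by (auto simp: ordered_bases_iff[OF V] lin_indep_def)
  then have "bs = []" if "bs \<in> ordered_bases n {0\<^sub>v n}" for bs
    using ordered_bases_length[OF V that] ordered_bases_length[OF V e] by simp
  then have "same_orientation n {0\<^sub>v n} `` {[]} = {[]}"
    using equiv_class_self[OF same_orientation_equiv[OF V] e] by (auto elim: same_orientationE)
  then show ?thesis
    using oriented_subspacesI[of "({0\<^sub>v n}, {[]})" n "[]"] V e by simp
qed

lemma flag_space_oriented:
  assumes F: "F \<in> oriented_flags n" and i: "i < n"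
  shows "flag_space n F i \<in> oriented_subspaces n"
    and "bs \<in> snd (flag_space n F i) \<Longrightarrow> length bs = i"
    and "j \<le> i \<Longrightarrow> fst (flag_space n F j) \<subseteq> fst (flag_space n F i)"
proof -
  have FX: "F p \<in> oriented_subspaces n"
    and Fd: "vectorspace.dim class_ring (sub_vs n (fst (F p))) = p" if "p \<in> {1..n-1}" for p
    using F that by (auto simp: oriented_flags_def)
  show X: "flag_space n F i \<in> oriented_subspaces n"
    using FX[of i] i oriented_zero_space by (auto simp: flag_space_def)
  show "length bs = i" if "bs \<in> snd (flag_space n F i)"
    using ordered_bases_length[OF oriented_subspacesD(1,2)[OF X], OF that] that Fd[of i] i
    by (auto simp: flag_space_def split: if_splits)
  show "fst (flag_space n F j) \<subseteq> fst (flag_space n F i)" if "j \<le> i"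
  proof (cases "j = 0")
    case True
    obtain bs where "bs \<in> snd (flag_space n F i)" using oriented_subspacesD(4)[OF X] by auto
    then show ?thesis
      using True zero_in_colspan[of n bs] positive_basis_spans[OF X] by (auto simp: flag_space_def)
  next
    case False
    then show ?thesis using F that i by (auto simp: oriented_flags_def flag_space_def)
  qed
qed

text \<open>Compatible positive bases for all members of a flag at once, so that all determinants attached to a
  triple of flags are built from the same three sequences of vectors.\<close>

definition adapted :: "nat \<Rightarrow> (nat \<Rightarrow> oriented_space) \<Rightarrow> (nat \<Rightarrow> real vec) \<Rightarrow> bool" where
  "adapted n F f \<longleftrightarrow> (\<forall>i<n. map f [0..<i] \<in> snd (flag_space n F i))"

text \<open>Extend a positive basis of one member of the flag by a vector of the next member; if the resulting
  basis is negative, negate the new vector, which leaves the earlier members untouched.\<close>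

lemma adapted_frame_exists:
  assumes F: "F \<in> oriented_flags n"
  obtains f where "\<And>i. f i \<in> carrier_vec n" and "adapted n F f"
proof -
  note fs = flag_space_oriented[OF F]
  have ex: "\<exists>bs. length bs = m \<and> (\<forall>i\<le>m. take i bs \<in> snd (flag_space n F i))" if "m < n" for m
    using that
  proof (induction m)
    case 0
    then show ?case by (auto simp: flag_space_def)
  next
    case (Suc m)
    then obtain bs where bs: "length bs = m" "\<And>i. i \<le> m \<Longrightarrow> take i bs \<in> snd (flag_space n F i)"
      by auto
    let ?X = "flag_space n F (Suc m)"
    have m: "m < n" using Suc.prems by simp
    have X: "?X \<in> oriented_subspaces n" by (rule fs(1)[OF Suc.prems])
    note V = oriented_subspacesD(1)[OF X]
    have "bs \<in> snd (flag_space n F m)" using bs(2)[of m] bs(1) by simp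
    then have li: "lin_indep n bs" and car: "set bs \<subseteq> carrier_vec n" and sp: "colspan n bs = fst (flag_space n F m)"
      using positive_basis_spans[OF fs(1)[OF m]] by auto
    have sub: "set bs \<subseteq> fst ?X"
      using set_subset_colspan[OF car] sp fs(3)[OF Suc.prems, of m] by auto
    obtain cs where cs: "cs \<in> snd ?X" using oriented_subspacesD(4)[OF X] by auto
    have csO: "cs \<in> ordered_bases n (fst ?X)" by (rule oriented_subspacesD(2)[OF X cs])
    have lcs: "length cs = Suc m" by (rule fs(2)[OF Suc.prems cs])
    obtain v where v: "v \<in> fst ?X" "bs @ [v] \<in> ordered_bases n (fst ?X)"
      using extend_to_ordered_basis[OF V csO _ li sub] lcs bs(1) by auto
    have vcar: "v \<in> carrier_vec n" using v(1) subspace_vectorspace(2)[OF V] by auto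
    obtain A where A: "A \<in> carrier_mat (Suc m) (Suc m)" "det A \<noteq> 0"
      "mat_of_cols n (bs @ [v]) = mat_of_cols n cs * A"
      using change_of_basis[OF V csO v(2)] lcs by metis
    have "\<exists>w. bs @ [w] \<in> snd ?X"
    proof (cases "0 < det A")
      case True
      then have "bs @ [v] \<in> snd ?X"
        using car vcar A lcs by (intro det_positive_same_orientation[OF X cs, of _ A]) auto
      then show ?thesis ..
    next
      case False
      \<comment> \<open>The matrix that negates the last basis vector.\<close>
      let ?E = "four_block_mat (1\<^sub>m m) (0\<^sub>m m 1) (0\<^sub>m 1 m) ((-1) \<cdot>\<^sub>m 1\<^sub>m 1) :: real mat"
      have E: "?E \<in> carrier_mat (Suc m) (Suc m)"
        using four_block_carrier_mat[of "1\<^sub>m m" m m "(-1) \<cdot>\<^sub>m 1\<^sub>m 1 :: real mat" 1 1] by simp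
      have dE: "det ?E = - 1"
        by (subst det_four_block_mat_lower_left_zero) auto
      have M: "mat_of_cols n cs \<in> carrier_mat n (Suc m)"
        using mat_of_cols_carrier(1)[of n cs] lcs by simp
      have v1: "mat_of_cols n [v] * ((-1) \<cdot>\<^sub>m 1\<^sub>m 1) = mat_of_cols n [- v]"
        using vcar by (intro eq_matI) (auto simp: mat_of_cols_index scalar_prod_def)
      have "mat_of_cols n (bs @ [- v]) = mat_of_cols n (bs @ [v]) * ?E"
        unfolding mat_of_cols_append
        by (subst mult_four_block_mat[of _ n m _ 1 _ 0 _ _ m _ 1]) (use bs(1) v1 in auto)
      also have "\<dots> = mat_of_cols n cs * (A * ?E)"
        unfolding A(3) by (rule assoc_mult_mat[OF M A(1) E])
      finally have eq: "mat_of_cols n (bs @ [- v]) = mat_of_cols n cs * (A * ?E)" .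
      have "0 < det (A * ?E)"
        unfolding det_mult[OF A(1) E] dE using False A(2) by simp
      then have "bs @ [- v] \<in> snd ?X"
        using car vcar mult_carrier_mat[OF A(1) E] lcs
        by (intro det_positive_same_orientation[OF X cs _ _ _ eq]) auto
      then show ?thesis ..
    qed
    then obtain w where w: "bs @ [w] \<in> snd ?X" ..
    have "take i (bs @ [w]) \<in> snd (flag_space n F i)" if "i \<le> Suc m" for i
      using that w bs by (cases "i = Suc m") auto
    then show ?case using bs(1) by (intro exI[of _ "bs @ [w]"]) auto
  qed
  show ?thesis
  proof (cases "n = 0")
    case True
    then show ?thesis using that[of "\<lambda>_. 0\<^sub>v n"] by (simp add: adapted_def)
  next
    case False
    then obtain bs where bs: "length bs = n - 1" "\<And>i. i < n \<Longrightarrow> take i bs \<in> snd (flag_space n F i)"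
      using ex[of "n - 1"] by auto
    \<comment> \<open>Only the first \<open>n - 1\<close> vectors matter; zero vectors pad the sequence.\<close>
    define f where "f i = (if i < n - 1 then bs ! i else 0\<^sub>v n)" for i
    have "map f [0..<i] = take i bs" if "i < n" for i
      using that bs(1) by (intro nth_equalityI) (auto simp: f_def)
    then have "adapted n F f" using bs(2) by (simp add: adapted_def)
    moreover have "f i \<in> carrier_vec n" for i
    proof -
      have "bs \<in> snd (flag_space n F (n - 1))" using bs(2)[of "n - 1"] bs(1) False by simp
      then have "set bs \<subseteq> carrier_vec n"
        using positive_basis_spans(1)[OF fs(1)[of "n - 1"]] False by simp
      then show ?thesis using bs(1) by (auto simp: f_def)
    qed
    ultimately show ?thesis using that by blast
  qed
qed

text \<open>Negating a whole frame multiplies the orientation of the \<open>i\<close>-dimensional member by \<open>(- 1)\<^sup>i\<close>.\<close>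

lemma adapted_flip_odd:
  assumes F: "F \<in> oriented_flags n" and f: "adapted n F f" and car: "\<And>i. f i \<in> carrier_vec n"
  shows "flip_odd n F \<in> oriented_flags n" and "adapted n (flip_odd n F) (signed (- 1) f)"
proof -
  note fs = flag_space_oriented[OF F]
  have flip: "flag_space n (flip_odd n F) i =
      (if odd i then reverse_orientation n (flag_space n F i) else flag_space n F i)" if "i < n" for i
    using that by (auto simp: flag_space_def flip_odd_def)
  have *: "flag_space n (flip_odd n F) i \<in> oriented_subspaces n \<and>
      map (signed (- 1) f) [0..<i] \<in> snd (flag_space n (flip_odd n F) i)" if i: "i < n" for i
  proof -
    have bs: "map f [0..<i] \<in> snd (flag_space n F i)" using f i by (simp add: adapted_def)
    have A: "(- 1) \<cdot>\<^sub>m 1\<^sub>m i \<in> carrier_mat (length (map f [0..<i])) (length (map f [0..<i]))"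
      "det ((- 1) \<cdot>\<^sub>m 1\<^sub>m i) = (- 1 :: real) ^ i" by simp_all
    have cs: "set (map (signed (- 1) f) [0..<i]) \<subseteq> carrier_vec n" using car by auto
    note eq = mat_of_cols_signed[of i f n "- 1", OF car]
    show ?thesis
      using det_negative_reverse_orientation[OF fs(1)[OF i] bs cs A(1) _ eq]
        det_positive_same_orientation[OF fs(1)[OF i] bs cs A(1) _ eq] fs(1)[OF i]
      by (simp add: flip[OF i] A(2) del: map_eq_conv)
  qed
  then show "adapted n (flip_odd n F) (signed (- 1) f)" by (simp add: adapted_def)
  have "flip_odd n F i \<in> oriented_subspaces n" if "i \<in> {1..n-1}" for i
    using *[of i] that by (auto simp: flag_space_def)
  moreover have "fst (flip_odd n F i) = fst (F i)" if "i \<in> {1..n-1}" for i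
    using that by (simp add: flip_odd_def reverse_orientation_def)
  moreover have "flip_odd n F \<in> extensional {1..n-1}" by (simp add: flip_odd_def)
  ultimately show "flip_odd n F \<in> oriented_flags n"
    using F by (simp add: oriented_flags_def PiE_def)
qed

text \<open>The lifts of an element of \<^const>\<open>Flag_plus\<close> are described by a single frame, up to negation of the
  whole frame when \<open>n\<close> is even.\<close>

definition represents :: "nat \<Rightarrow> (nat \<Rightarrow> real vec) \<Rightarrow> (nat \<Rightarrow> oriented_space) set \<Rightarrow> bool" where
  "represents n f F \<longleftrightarrow> (\<forall>i. f i \<in> carrier_vec n) \<and> F \<subseteq> oriented_flags n \<and>
     (\<forall>G\<in>F. \<exists>s\<in>lift_signs n. adapted n G (signed s f)) \<and>
     (\<forall>s\<in>lift_signs n. \<exists>G\<in>F. adapted n G (signed s f))"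

lemma representing_frame_exists:
  assumes "F \<in> Flag_plus n"
  obtains f where "represents n f F"
proof -
  obtain G where G: "G \<in> oriented_flags n" and F: "F = flag_rel n `` {G}"
    using assms by (auto simp: Flag_plus_def elim: quotientE)
  obtain f where car: "\<And>i. f i \<in> carrier_vec n" and f: "adapted n G f"
    using adapted_frame_exists[OF G] by blast
  note flip = adapted_flip_odd[OF G f car]
  have "F = (if even n then {G, flip_odd n G} else {G})"
    using G flip(1) by (auto simp: F flag_rel_def)
  then have "represents n f F"
    using G flip f car by (auto simp: represents_def lift_signs_def)
  then show ?thesis by (rule that)
qed

lemma lifts_hyperconvex_iff:
  assumes G: "G1 \<in> oriented_flags n" "G2 \<in> oriented_flags n" "G3 \<in> oriented_flags n"
    and f: "adapted n G1 f1" "adapted n G2 f2" "adapted n G3 f3" and n: "n \<ge> 1"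
  shows "(\<forall>i1\<in>{0..n-1}. \<forall>i2\<in>{0..n-1}. \<forall>i3\<in>{0..n-1}. i1 + i2 + i3 = n \<longrightarrow>
          (let X1 = flag_space n G1 i1; X2 = flag_space n G2 i2; X3 = flag_space n G3 i3
           in independent_sum n X1 X2 \<and>
              independent_sum n (oriented_sum n X1 X2) X3 \<and>
              oriented_sum n (oriented_sum n X1 X2) X3 = standard_oriented_Rn n))
         \<longleftrightarrow> positive_triple n f1 f2 f3"
proof -
  have "{0..n-1} = {..<n}" using n by auto
  moreover have "(let X1 = flag_space n G1 i1; X2 = flag_space n G2 i2; X3 = flag_space n G3 i3
           in independent_sum n X1 X2 \<and>
              independent_sum n (oriented_sum n X1 X2) X3 \<and>
              oriented_sum n (oriented_sum n X1 X2) X3 = standard_oriented_Rn n) \<longleftrightarrow>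
        0 < cdet n (map f1 [0..<i1] @ map f2 [0..<i2] @ map f3 [0..<i3])"
    if "i1 < n" "i2 < n" "i3 < n" "i1 + i2 + i3 = n" for i1 i2 i3
    unfolding Let_def
    using that f G by (intro oriented_triple_sum_iff) (auto simp: adapted_def flag_space_oriented(1))
  ultimately show ?thesis
    unfolding positive_triple_def by (auto simp del: Let_def)
qed

lemma hyperconvex_iff:
  assumes r: "represents n f1 F1" "represents n f2 F2" "represents n f3 F3" and n: "n \<ge> 1"
  shows "hyperconvex n F1 F2 F3 \<longleftrightarrow>
    (\<exists>s1\<in>lift_signs n. \<exists>s2\<in>lift_signs n. \<exists>s3\<in>lift_signs n.
       positive_triple n (signed s1 f1) (signed s2 f2) (signed s3 f3))" (is "_ \<longleftrightarrow> ?R")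
proof
  have flags: "F1 \<subseteq> oriented_flags n" "F2 \<subseteq> oriented_flags n" "F3 \<subseteq> oriented_flags n"
    using r by (auto simp: represents_def)
  {
    assume "hyperconvex n F1 F2 F3"
    then obtain G1 G2 G3 where G: "G1 \<in> F1" "G2 \<in> F2" "G3 \<in> F3" and
      h: "\<forall>i1\<in>{0..n-1}. \<forall>i2\<in>{0..n-1}. \<forall>i3\<in>{0..n-1}. i1 + i2 + i3 = n \<longrightarrow>
          (let X1 = flag_space n G1 i1; X2 = flag_space n G2 i2; X3 = flag_space n G3 i3
           in independent_sum n X1 X2 \<and>
              independent_sum n (oriented_sum n X1 X2) X3 \<and>
              oriented_sum n (oriented_sum n X1 X2) X3 = standard_oriented_Rn n)"
      unfolding hyperconvex_def by blast
    obtain s1 s2 s3 where s: "s1 \<in> lift_signs n" "s2 \<in> lift_signs n" "s3 \<in> lift_signs n"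
      and a: "adapted n G1 (signed s1 f1)" "adapted n G2 (signed s2 f2)" "adapted n G3 (signed s3 f3)"
      using r G unfolding represents_def by meson
    have "positive_triple n (signed s1 f1) (signed s2 f2) (signed s3 f3)"
      using lifts_hyperconvex_iff[OF _ _ _ a n] G flags h by blast
    then show ?R using s by blast
  next
    assume ?R
    then obtain s1 s2 s3 where s: "s1 \<in> lift_signs n" "s2 \<in> lift_signs n" "s3 \<in> lift_signs n"
      and p: "positive_triple n (signed s1 f1) (signed s2 f2) (signed s3 f3)"
      by blast
    obtain G1 G2 G3 where G: "G1 \<in> F1" "G2 \<in> F2" "G3 \<in> F3"
      and a: "adapted n G1 (signed s1 f1)" "adapted n G2 (signed s2 f2)" "adapted n G3 (signed s3 f3)"
      using r s unfolding represents_def by meson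
    show "hyperconvex n F1 F2 F3"
      unfolding hyperconvex_def
      using lifts_hyperconvex_iff[OF _ _ _ a n] G flags p by blast
  }
qed


section \<open>The partial cyclic order\<close>

theorem proposition3p7:
  fixes n :: nat
  assumes "n \<ge> 2"
  shows "partial_cyclic_order (Flag_plus n)
           {(F1, F2, F3). F1 \<in> Flag_plus n \<and> F2 \<in> Flag_plus n \<and> F3 \<in> Flag_plus n \<and>
              hyperconvex n F1 F2 F3}"
proof -
  have n: "n \<ge> 1" using assms by simp
  have car: "f i \<in> carrier_vec n" if "represents n f F" for f F i
    using that by (simp add: represents_def)
  have "hyperconvex n F2 F3 F1"
    if F: "F1 \<in> Flag_plus n" "F2 \<in> Flag_plus n" "F3 \<in> Flag_plus n" "hyperconvex n F1 F2 F3" for F1 F2 F3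
  proof -
    obtain f1 f2 f3 where r: "represents n f1 F1" "represents n f2 F2" "represents n f3 F3"
      using representing_frame_exists F by metis
    obtain s1 s2 s3 where s: "s1 \<in> lift_signs n" "s2 \<in> lift_signs n" "s3 \<in> lift_signs n"
      and "positive_triple n (signed s1 f1) (signed s2 f2) (signed s3 f3)"
      using F(4) unfolding hyperconvex_iff[OF r n] by blast
    then have "positive_triple n (signed s2 f2) (signed s3 f3) (signed ((if even n then - 1 else 1) * s1) f1)"
      using positive_triple_rotate[of n "signed s1 f1" "signed s2 f2" "signed s3 f3"] r[THEN car] by simp
    moreover have "(if even n then - 1 else 1) * s1 \<in> lift_signs n"
      using s(1) by (auto simp: lift_signs_def split: if_splits)
    ultimately show ?thesis
      using s unfolding hyperconvex_iff[OF r(2,3,1) n] by blast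
  qed
  moreover have "\<not> hyperconvex n F3 F2 F1"
    if F: "F1 \<in> Flag_plus n" "F2 \<in> Flag_plus n" "F3 \<in> Flag_plus n" "hyperconvex n F1 F2 F3" for F1 F2 F3
  proof
    assume h: "hyperconvex n F3 F2 F1"
    obtain f1 f2 f3 where r: "represents n f1 F1" "represents n f2 F2" "represents n f3 F3"
      using representing_frame_exists F by metis
    obtain s1 s2 s3 where s: "s1 \<in> lift_signs n" "s2 \<in> lift_signs n" "s3 \<in> lift_signs n"
      and p: "positive_triple n (signed s1 f1) (signed s2 f2) (signed s3 f3)"
      using F(4) unfolding hyperconvex_iff[OF r n] by blast
    obtain t1 t2 t3 where t: "t1 \<in> lift_signs n" "t2 \<in> lift_signs n" "t3 \<in> lift_signs n"
      and q: "positive_triple n (signed t3 f3) (signed t2 f2) (signed t1 f1)"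
      using h unfolding hyperconvex_iff[OF r(3,2,1) n] by blast
    have eq: "signed t f = signed (t * s) (signed s f)" if "s \<in> lift_signs n" for s t f
      using lift_signs_cases[OF that] by auto
    show False
      using positive_triple_not_reversed[OF p, of "t3 * s3" "t2 * s2" "t1 * s1"]
        q eq[OF s(1)] eq[OF s(2)] eq[OF s(3)] s t r[THEN car] assms
      by (simp add: lift_signs_mult)
  qed
  moreover have "hyperconvex n F1 F2 F4"
    if F: "F1 \<in> Flag_plus n" "F2 \<in> Flag_plus n" "F3 \<in> Flag_plus n" "F4 \<in> Flag_plus n"
      "hyperconvex n F1 F2 F3" "hyperconvex n F1 F3 F4" for F1 F2 F3 F4
  proof -
    obtain f1 f2 f3 f4 where r: "represents n f1 F1" "represents n f2 F2" "represents n f3 F3" "represents n f4 F4"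
      using representing_frame_exists F by metis
    obtain s1 s2 s3 where s: "s1 \<in> lift_signs n" "s2 \<in> lift_signs n" "s3 \<in> lift_signs n"
      and p: "positive_triple n (signed s1 f1) (signed s2 f2) (signed s3 f3)"
      using F(5) unfolding hyperconvex_iff[OF r(1,2,3) n] by blast
    obtain t1 t3 t4 where t: "t1 \<in> lift_signs n" "t3 \<in> lift_signs n" "t4 \<in> lift_signs n"
      and q: "positive_triple n (signed t1 f1) (signed t3 f3) (signed t4 f4)"
      using F(6) unfolding hyperconvex_iff[OF r(1,3,4) n] by blast
    have "positive_triple n (signed s1 f1) (signed s2 f2) (signed (s1 * t1 * t4) f4)"
      using signed_positive_triple_transitive[OF p q s(1,3) t(1,2) assms] r[THEN car] by blast
    moreover have "s1 * t1 * t4 \<in> lift_signs n"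
      using s t by (simp add: lift_signs_mult)
    ultimately show ?thesis
      using s unfolding hyperconvex_iff[OF r(1,2,4) n] by blast
  qed
  ultimately show ?thesis
    unfolding partial_cyclic_order_def by blast
qed

end
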